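(* Let $\mathcal A$ be an abelian category with enough projectives, let $\mathcal G$ be a class of objects of $\mathcal A$, let $1\le m\in\mathbb N$, and let $\mathcal F={}^{\perp_m}\mathcal G$. Then $\mathcal F$ defines a homological dimension if and only if $\mathcal F={}^{\perp_\infty}\mathcal G$. In such a case $\mathcal A=\overline{\mathcal F}$.
   Context: Here $\mathbb N$ includes $0$. For $m\ge1$, ${}^{\perp_m}\mathcal G=\{M\in\mathcal A:\operatorname{Ext}^i_{\mathcal A}(M,G)=0\ \forall\,1\le i\le m,\ G\in\mathcal G\}$, and ${}^{\perp_\infty}\mathcal G=\bigcap_{m\ge1}{}^{\perp_m}\mathcal G$. $\overline{\mathcal F}$ is the class of all objects of $\mathcal A$ which are homomorphic images (quotients) of objects in $\mathcal F$. For $\alpha\in\mathbb N\cup\{\infty\}$, $\mathcal F_\alpha$ is the class of objects $M$ of $\mathcal A$ for which there is a long exact sequence $\cdots\to F_i\to F_{i-1}\to\cdots\to F_1\to F_0\to M\to 0$ with each $F_i\in\mathcal F\cup\{0\}$ and $F_i=0$ for $i>\alpha$. The class $\mathcal F$ defines a homological dimension if: (1) for any short exact sequence $0\to K\to F\to M\to 0$ with $F\in\mathcal F$ and $M\in\mathcal F_\infty$, the object $K$ belongs to $\mathcal F_\infty$; and (2) for every $n\in\mathbb N$ and any exact sequence $0\to K_n\to F_{n-1}\to\cdots\to F_1\to F_0\to X\to 0$ with $F_i\in\mathcal F$ for $i=0,\dots,n-1$ and $X\in\mathcal F_n$, the object $K_n$ belongs to $\mathcal F$. *)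

theory Defs
  imports "HOL-Algebra.Elementary_Groups" "HOL-Library.Extended_Nat"
begin

section \<open>Abelian categories\<close>

text \<open>
  Every arrow has a unique domain and codomain, so hom-sets are pairwise disjoint. Composition is
  written in the usual order (\<open>g \<cdot> f\<close> is \<open>f\<close> followed by \<open>g\<close>) and is only meaningful for composable
  arrows. \<open>Hgrp C a b\<close> is the abelian group of arrows from \<open>a\<close> to \<open>b\<close>, as a group of HOL-Algebra:
  its multiplication is the addition of arrows and its unit is the zero arrow.
\<close>

record ('o, 'm) precategory =
  Obj :: "'o set"
  Arr :: "'m set"
  Dom :: "'m \<Rightarrow> 'o"
  Cod :: "'m \<Rightarrow> 'o"
  Idn :: "'o \<Rightarrow> 'm"
  Comp :: "'m \<Rightarrow> 'm \<Rightarrow> 'm" (infixl "\<cdot>\<index>" 70)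
  Hgrp :: "'o \<Rightarrow> 'o \<Rightarrow> 'm monoid"

definition Homs :: "('o, 'm, 'x) precategory_scheme \<Rightarrow> 'o \<Rightarrow> 'o \<Rightarrow> 'm set" where
  "Homs C a b = {f \<in> Arr C. Dom C f = a \<and> Cod C f = b}"

abbreviation zero_arr :: "('o, 'm, 'x) precategory_scheme \<Rightarrow> 'o \<Rightarrow> 'o \<Rightarrow> 'm" where
  "zero_arr C a b \<equiv> \<one>\<^bsub>Hgrp C a b\<^esub>"

locale category =
  fixes C :: "('o, 'm, 'x) precategory_scheme" (structure)
  assumes dom_obj: "f \<in> Arr C \<Longrightarrow> Dom C f \<in> Obj C"
    and cod_obj: "f \<in> Arr C \<Longrightarrow> Cod C f \<in> Obj C"
    and idn_hom: "a \<in> Obj C \<Longrightarrow> Idn C a \<in> Homs C a a"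
    and comp_hom: "\<lbrakk>f \<in> Homs C a b; g \<in> Homs C b c\<rbrakk> \<Longrightarrow> g \<cdot> f \<in> Homs C a c"
    and comp_idn: "f \<in> Homs C a b \<Longrightarrow> f \<cdot> Idn C a = f"
    and idn_comp: "f \<in> Homs C a b \<Longrightarrow> Idn C b \<cdot> f = f"
    and comp_assoc: "\<lbrakk>f \<in> Homs C a b; g \<in> Homs C b c; h \<in> Homs C c d\<rbrakk>
      \<Longrightarrow> h \<cdot> (g \<cdot> f) = (h \<cdot> g) \<cdot> f"

locale preadditive_category = category +
  assumes hgrp_carrier: "\<lbrakk>a \<in> Obj C; b \<in> Obj C\<rbrakk> \<Longrightarrow> carrier (Hgrp C a b) = Homs C a b"
    and hgrp_comm_group: "\<lbrakk>a \<in> Obj C; b \<in> Obj C\<rbrakk> \<Longrightarrow> comm_group (Hgrp C a b)"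
    and postcomp_additive: "\<lbrakk>a \<in> Obj C; g \<in> Homs C b c\<rbrakk>
      \<Longrightarrow> (\<lambda>f. g \<cdot> f) \<in> hom (Hgrp C a b) (Hgrp C a c)"
    and precomp_additive: "\<lbrakk>f \<in> Homs C a b; c \<in> Obj C\<rbrakk>
      \<Longrightarrow> (\<lambda>g. g \<cdot> f) \<in> hom (Hgrp C b c) (Hgrp C a c)"

definition monic :: "('o, 'm, 'x) precategory_scheme \<Rightarrow> 'm \<Rightarrow> bool" where
  "monic C f \<longleftrightarrow> f \<in> Arr C \<and>
    (\<forall>a. \<forall>u \<in> Homs C a (Dom C f). \<forall>v \<in> Homs C a (Dom C f). f \<cdot>\<^bsub>C\<^esub> u = f \<cdot>\<^bsub>C\<^esub> v \<longrightarrow> u = v)"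

definition epic :: "('o, 'm, 'x) precategory_scheme \<Rightarrow> 'm \<Rightarrow> bool" where
  "epic C f \<longleftrightarrow> f \<in> Arr C \<and>
    (\<forall>b. \<forall>u \<in> Homs C (Cod C f) b. \<forall>v \<in> Homs C (Cod C f) b. u \<cdot>\<^bsub>C\<^esub> f = v \<cdot>\<^bsub>C\<^esub> f \<longrightarrow> u = v)"

definition zero_object :: "('o, 'm, 'x) precategory_scheme \<Rightarrow> 'o \<Rightarrow> bool" where
  "zero_object C z \<longleftrightarrow> z \<in> Obj C \<and>
    (\<forall>a \<in> Obj C. (\<exists>!f. f \<in> Homs C a z) \<and> (\<exists>!f. f \<in> Homs C z a))"

definition is_kernel :: "('o, 'm, 'x) precategory_scheme \<Rightarrow> 'm \<Rightarrow> 'm \<Rightarrow> bool" where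
  "is_kernel C k f \<longleftrightarrow> f \<in> Arr C \<and> k \<in> Arr C \<and> Cod C k = Dom C f \<and>
    f \<cdot>\<^bsub>C\<^esub> k = zero_arr C (Dom C k) (Cod C f) \<and>
    (\<forall>a. \<forall>h \<in> Homs C a (Dom C f). f \<cdot>\<^bsub>C\<^esub> h = zero_arr C a (Cod C f) \<longrightarrow>
      (\<exists>!u. u \<in> Homs C a (Dom C k) \<and> k \<cdot>\<^bsub>C\<^esub> u = h))"

definition is_cokernel :: "('o, 'm, 'x) precategory_scheme \<Rightarrow> 'm \<Rightarrow> 'm \<Rightarrow> bool" where
  "is_cokernel C c f \<longleftrightarrow> f \<in> Arr C \<and> c \<in> Arr C \<and> Dom C c = Cod C f \<and>
    c \<cdot>\<^bsub>C\<^esub> f = zero_arr C (Dom C f) (Cod C c) \<and>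
    (\<forall>b. \<forall>h \<in> Homs C (Cod C f) b. h \<cdot>\<^bsub>C\<^esub> f = zero_arr C (Dom C f) b \<longrightarrow>
      (\<exists>!u. u \<in> Homs C (Cod C c) b \<and> u \<cdot>\<^bsub>C\<^esub> c = h))"

definition has_biproduct :: "('o, 'm, 'x) precategory_scheme \<Rightarrow> 'o \<Rightarrow> 'o \<Rightarrow> bool" where
  "has_biproduct C a b \<longleftrightarrow> (\<exists>s \<in> Obj C.
    \<exists>i1 \<in> Homs C a s. \<exists>i2 \<in> Homs C b s. \<exists>p1 \<in> Homs C s a. \<exists>p2 \<in> Homs C s b.
      p1 \<cdot>\<^bsub>C\<^esub> i1 = Idn C a \<and> p2 \<cdot>\<^bsub>C\<^esub> i2 = Idn C b \<and>
      p1 \<cdot>\<^bsub>C\<^esub> i2 = zero_arr C b a \<and> p2 \<cdot>\<^bsub>C\<^esub> i1 = zero_arr C a b \<and>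
      (i1 \<cdot>\<^bsub>C\<^esub> p1) \<otimes>\<^bsub>Hgrp C s s\<^esub> (i2 \<cdot>\<^bsub>C\<^esub> p2) = Idn C s)"

locale abelian_category = preadditive_category +
  assumes ex_zero_object: "\<exists>z. zero_object C z"
    and ex_biproduct: "\<lbrakk>a \<in> Obj C; b \<in> Obj C\<rbrakk> \<Longrightarrow> has_biproduct C a b"
    and ex_kernel: "f \<in> Arr C \<Longrightarrow> \<exists>k. is_kernel C k f"
    and ex_cokernel: "f \<in> Arr C \<Longrightarrow> \<exists>c. is_cokernel C c f"
    and monic_is_kernel: "monic C f \<Longrightarrow> \<exists>g. is_kernel C f g"
    and epic_is_cokernel: "epic C f \<Longrightarrow> \<exists>g. is_cokernel C f g"

definition projective :: "('o, 'm, 'x) precategory_scheme \<Rightarrow> 'o \<Rightarrow> bool" where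
  "projective C p \<longleftrightarrow> p \<in> Obj C \<and>
    (\<forall>e f. epic C e \<and> f \<in> Homs C p (Cod C e) \<longrightarrow> (\<exists>g \<in> Homs C p (Dom C e). e \<cdot>\<^bsub>C\<^esub> g = f))"

definition enough_projectives :: "('o, 'm, 'x) precategory_scheme \<Rightarrow> bool" where
  "enough_projectives C \<longleftrightarrow>
    (\<forall>a \<in> Obj C. \<exists>p e. projective C p \<and> e \<in> Homs C p a \<and> epic C e)"


section \<open>Exact sequences\<close>

definition is_image :: "('o, 'm, 'x) precategory_scheme \<Rightarrow> 'm \<Rightarrow> 'm \<Rightarrow> bool" where
  "is_image C i f \<longleftrightarrow> (\<exists>c. is_cokernel C c f \<and> is_kernel C i c)"

text \<open>Exactness of \<open>f\<close> followed by \<open>g\<close> at the middle object: the image of \<open>f\<close> and the kernel of \<open>g\<close>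
  are the same subobject, i.e. some arrow represents both.\<close>

definition exact_at :: "('o, 'm, 'x) precategory_scheme \<Rightarrow> 'm \<Rightarrow> 'm \<Rightarrow> bool" where
  "exact_at C f g \<longleftrightarrow> (\<exists>i. is_image C i f \<and> is_kernel C i g)"

definition null_obj :: "('o, 'm, 'x) precategory_scheme \<Rightarrow> 'o" where
  "null_obj C = (SOME z. zero_object C z)"

abbreviation from_null :: "('o, 'm, 'x) precategory_scheme \<Rightarrow> 'o \<Rightarrow> 'm" where
  "from_null C a \<equiv> zero_arr C (null_obj C) a"

abbreviation to_null :: "('o, 'm, 'x) precategory_scheme \<Rightarrow> 'o \<Rightarrow> 'm" where
  "to_null C a \<equiv> zero_arr C a (null_obj C)"

definition short_exact ::
  "('o, 'm, 'x) precategory_scheme \<Rightarrow> 'o \<Rightarrow> 'm \<Rightarrow> 'o \<Rightarrow> 'm \<Rightarrow> 'o \<Rightarrow> bool" where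
  "short_exact C k f a g b \<longleftrightarrow> f \<in> Homs C k a \<and> g \<in> Homs C a b \<and>
    exact_at C (from_null C k) f \<and> exact_at C f g \<and> exact_at C g (to_null C b)"

text \<open>The long exact sequence \<open>\<dots> \<rightarrow> X 1 \<rightarrow> X 0 \<rightarrow> M \<rightarrow> 0\<close>, where \<open>d 0\<close> is the arrow from \<open>X 0\<close> to \<open>M\<close>
  and \<open>d (Suc i)\<close> the one from \<open>X (Suc i)\<close> to \<open>X i\<close>.\<close>

definition long_exact ::
  "('o, 'm, 'x) precategory_scheme \<Rightarrow> (nat \<Rightarrow> 'o) \<Rightarrow> (nat \<Rightarrow> 'm) \<Rightarrow> 'o \<Rightarrow> bool" where
  "long_exact C X d M \<longleftrightarrow> d 0 \<in> Homs C (X 0) M \<and> (\<forall>i. d (Suc i) \<in> Homs C (X (Suc i)) (X i)) \<and>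
    exact_at C (d 0) (to_null C M) \<and> (\<forall>i. exact_at C (d (Suc i)) (d i))"

text \<open>The exact sequence \<open>0 \<rightarrow> X n \<rightarrow> X (n - 1) \<rightarrow> \<dots> \<rightarrow> X 0 \<rightarrow> M \<rightarrow> 0\<close>, with arrows indexed as above;
  for \<open>n = 0\<close> it is \<open>0 \<rightarrow> X 0 \<rightarrow> M \<rightarrow> 0\<close>.\<close>

definition finite_exact ::
  "('o, 'm, 'x) precategory_scheme \<Rightarrow> nat \<Rightarrow> (nat \<Rightarrow> 'o) \<Rightarrow> (nat \<Rightarrow> 'm) \<Rightarrow> 'o \<Rightarrow> bool" where
  "finite_exact C n X d M \<longleftrightarrow>
    d 0 \<in> Homs C (X 0) M \<and> (\<forall>i<n. d (Suc i) \<in> Homs C (X (Suc i)) (X i)) \<and>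
    exact_at C (d 0) (to_null C M) \<and> (\<forall>i<n. exact_at C (d (Suc i)) (d i)) \<and>
    exact_at C (from_null C (X n)) (d n)"


section \<open>Ext groups\<close>

text \<open>\<open>Ext\<^sup>i(M, N)\<close> is the \<open>i\<close>-th cohomology group of the complex \<open>Hom(P\<^sub>\<bullet>, N)\<close> for a projective
  resolution \<open>P\<^sub>\<bullet>\<close> of \<open>M\<close>.\<close>

definition proj_resolution ::
  "('o, 'm, 'x) precategory_scheme \<Rightarrow> 'o \<Rightarrow> (nat \<Rightarrow> 'o) \<Rightarrow> (nat \<Rightarrow> 'm) \<Rightarrow> bool" where
  "proj_resolution C M P d \<longleftrightarrow> long_exact C P d M \<and> (\<forall>i. projective C (P i))"

definition coboundary ::
  "('o, 'm, 'x) precategory_scheme \<Rightarrow> (nat \<Rightarrow> 'm) \<Rightarrow> nat \<Rightarrow> 'm \<Rightarrow> 'm" where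
  "coboundary C d i f = f \<cdot>\<^bsub>C\<^esub> d (Suc i)"

definition cocycles ::
  "('o, 'm, 'x) precategory_scheme \<Rightarrow> (nat \<Rightarrow> 'o) \<Rightarrow> (nat \<Rightarrow> 'm) \<Rightarrow> 'o \<Rightarrow> nat \<Rightarrow> 'm set" where
  "cocycles C P d N i = kernel (Hgrp C (P i) N) (Hgrp C (P (Suc i)) N) (coboundary C d i)"

definition coboundaries ::
  "('o, 'm, 'x) precategory_scheme \<Rightarrow> (nat \<Rightarrow> 'o) \<Rightarrow> (nat \<Rightarrow> 'm) \<Rightarrow> 'o \<Rightarrow> nat \<Rightarrow> 'm set" where
  "coboundaries C P d N i = (case i of
      0 \<Rightarrow> {zero_arr C (P 0) N}
    | Suc j \<Rightarrow> coboundary C d j ` carrier (Hgrp C (P j) N))"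

definition Hom_cohomology ::
  "('o, 'm, 'x) precategory_scheme \<Rightarrow> (nat \<Rightarrow> 'o) \<Rightarrow> (nat \<Rightarrow> 'm) \<Rightarrow> 'o \<Rightarrow> nat \<Rightarrow> 'm set monoid" where
  "Hom_cohomology C P d N i =
    (Hgrp C (P i) N)\<lparr>carrier := cocycles C P d N i\<rparr> Mod coboundaries C P d N i"

text \<open>The group is computed from a chosen resolution. Only its isomorphism class is independent of
  the choice, and the definition is meaningful only if \<open>M\<close> has a projective resolution.\<close>

definition Ext :: "('o, 'm, 'x) precategory_scheme \<Rightarrow> nat \<Rightarrow> 'o \<Rightarrow> 'o \<Rightarrow> 'm set monoid" where
  "Ext C i M N =
    (let (P, d) = (SOME (P, d). proj_resolution C M P d) in Hom_cohomology C P d N i)"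


section \<open>Orthogonal classes and homological dimensions\<close>

definition perp :: "('o, 'm, 'x) precategory_scheme \<Rightarrow> nat \<Rightarrow> 'o set \<Rightarrow> 'o set" where
  "perp C m G = {M \<in> Obj C. \<forall>i N. 1 \<le> i \<and> i \<le> m \<and> N \<in> G \<longrightarrow> trivial_group (Ext C i M N)}"

definition perp_inf :: "('o, 'm, 'x) precategory_scheme \<Rightarrow> 'o set \<Rightarrow> 'o set" where
  "perp_inf C G = (\<Inter>m \<in> {1..}. perp C m G)"

definition quotient_class :: "('o, 'm, 'x) precategory_scheme \<Rightarrow> 'o set \<Rightarrow> 'o set" where
  "quotient_class C F = {M \<in> Obj C. \<exists>a \<in> F. \<exists>e \<in> Homs C a M. epic C e}"

text \<open>\<open>F \<union> {0}\<close> is read up to isomorphism of the zero object.\<close>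

definition dim_class :: "('o, 'm, 'x) precategory_scheme \<Rightarrow> 'o set \<Rightarrow> enat \<Rightarrow> 'o set" where
  "dim_class C F \<alpha> = {M \<in> Obj C. \<exists>X d. long_exact C X d M \<and>
    (\<forall>i. X i \<in> F \<or> zero_object C (X i)) \<and> (\<forall>i. enat i > \<alpha> \<longrightarrow> zero_object C (X i))}"

definition defines_homological_dimension ::
  "('o, 'm, 'x) precategory_scheme \<Rightarrow> 'o set \<Rightarrow> bool" where
  "defines_homological_dimension C F \<longleftrightarrow>
    (\<forall>K f A g M. short_exact C K f A g M \<and> A \<in> F \<and> M \<in> dim_class C F \<infinity> \<longrightarrow> K \<in> dim_class C F \<infinity>) \<and>
    (\<forall>n X d M. finite_exact C n X d M \<and> (\<forall>i<n. X i \<in> F) \<and> M \<in> dim_class C F (enat n) \<longrightarrow> X n \<in> F)"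

end

theory Submission imports Defs begin

text \<open>
  Every object is a quotient of a projective object, and projective objects lie in \<open>F\<close>; this gives the
  last claim. The two directions of the equivalence rest on dimension shifting along syzygies.

  Suppose that \<open>F = \<^sup>\<bottom>\<^sup>m G\<close> defines a homological dimension, and let \<open>M \<in> F\<close> with a presentation
  \<open>0 \<rightarrow> K \<rightarrow> P \<rightarrow> M \<rightarrow> 0\<close> by a projective object \<open>P\<close>. Then \<open>P \<in> F\<close>, and \<open>M\<close> has \<open>F\<close>-dimension \<open>0\<close>, hence at most
  \<open>1\<close>, so the second condition on \<open>F\<close> gives \<open>K \<in> F\<close>. Thus every syzygy of \<open>M\<close> lies in \<open>F\<close>, and since
  \<open>Ext\<^sup>i\<^sup>+\<^sup>1(M, N) = Ext\<^sup>1(\<Omega>\<^sup>i M, N)\<close> and \<open>m \<ge> 1\<close>, all higher Ext groups from \<open>M\<close> to objects of \<open>G\<close>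
  vanish.

  Conversely let \<open>F = \<^sup>\<bottom>\<^sup>\<infinity> G\<close>. The first condition is trivial, because every object has a projective
  resolution and \<open>F\<close> contains the projective objects. For the second one, an \<open>F\<close>-resolution of \<open>M\<close> of
  length \<open>n\<close> shows \<open>Ext\<^sup>i(M, N) = 0\<close> for \<open>i > n\<close> and \<open>N \<in> G\<close> (\<open>ext_vanishes_above_dimension\<close>), and along
  any exact sequence \<open>0 \<rightarrow> X n \<rightarrow> \<dots> \<rightarrow> X 0 \<rightarrow> M \<rightarrow> 0\<close> with the other terms in \<open>F\<close> the vanishing is shifted
  back to \<open>Ext\<^sup>i(X n, N) = 0\<close> for \<open>i > 0\<close> (\<open>ext_vanishes_last_syzygy\<close>).

  All of this concerns only the vanishing of Ext groups, and vanishing can be treated without the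
  groups themselves. Vanishing of \<open>Ext\<^sup>1(M, N)\<close> is expressed by an extension property: for
  every short exact sequence \<open>0 \<rightarrow> K \<rightarrow> A \<rightarrow> M \<rightarrow> 0\<close> each arrow \<open>K \<rightarrow> N\<close> extends to \<open>A\<close>. Higher vanishing
  is defined by passing to syzygies, for all projective presentations at once. For a short exact
  sequence \<open>0 \<rightarrow> X \<rightarrow> Y \<rightarrow> Z \<rightarrow> 0\<close> the parts of the long exact sequence that are needed become three
  implications between vanishing statements, for \<open>i \<ge> 1\<close> and a fixed second argument:
  \<^item> (extension) \<open>Ext\<^sup>i(X) = 0\<close> and \<open>Ext\<^sup>i(Z) = 0\<close> imply \<open>Ext\<^sup>i(Y) = 0\<close>;
  \<^item> (kernel) \<open>Ext\<^sup>i(Y) = 0\<close> and \<open>Ext\<^sup>i\<^sup>+\<^sup>1(Z) = 0\<close> imply \<open>Ext\<^sup>i(X) = 0\<close>;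
  \<^item> (quotient) \<open>Ext\<^sup>i(X) = 0\<close> and \<open>Ext\<^sup>i\<^sup>+\<^sup>1(Y) = 0\<close> imply \<open>Ext\<^sup>i\<^sup>+\<^sup>1(Z) = 0\<close>.

  These are proved together by induction on \<open>i\<close>. Two constructions, both instances of one pullback
  (\<open>pullback_short_exact\<close>), drive the induction: two short exact sequences onto the same object
  have a common pullback (\<open>short_exact_pullback\<close>), and a composite \<open>P \<rightarrow> Y \<rightarrow> Z\<close> of epimorphisms has a
  kernel that is an extension of the kernels (\<open>short_exact_composite\<close>). Finally
  \<open>trivial_Hom_cohomology_iff_ext_vanishes\<close> identifies this notion with triviality of the cohomology
  groups of any projective resolution, in particular of the one that is chosen to define Ext.
\<close>

section \<open>Arrows, kernels and cokernels\<close>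

context preadditive_category
begin

lemma hom_arr:
  assumes "f \<in> Homs C a b"
  shows "f \<in> Arr C" "Dom C f = a" "Cod C f = b" "a \<in> Obj C" "b \<in> Obj C"
  using assms dom_obj cod_obj by (auto simp: Homs_def)

lemma hgrp_group: "a \<in> Obj C \<Longrightarrow> b \<in> Obj C \<Longrightarrow> group (Hgrp C a b)"
  using hgrp_comm_group comm_group_def by blast

lemma zero_hom: "a \<in> Obj C \<Longrightarrow> b \<in> Obj C \<Longrightarrow> zero_arr C a b \<in> Homs C a b"
  using group.is_monoid[OF hgrp_group] monoid.one_closed hgrp_carrier by metis

lemma comp_zero: "g \<in> Homs C b c \<Longrightarrow> a \<in> Obj C \<Longrightarrow> g \<cdot> zero_arr C a b = zero_arr C a c"
  using hom_one[OF postcomp_additive hgrp_group hgrp_group] hom_arr by metis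

lemma zero_comp: "f \<in> Homs C a b \<Longrightarrow> c \<in> Obj C \<Longrightarrow> zero_arr C b c \<cdot> f = zero_arr C a c"
  using hom_one[OF precomp_additive hgrp_group hgrp_group] hom_arr by metis

definition diff_arr :: "'a \<Rightarrow> 'a \<Rightarrow> 'b \<Rightarrow> 'b \<Rightarrow> 'b" where
  "diff_arr a b f g = f \<otimes>\<^bsub>Hgrp C a b\<^esub> inv\<^bsub>Hgrp C a b\<^esub> g"

lemma diff_hom:
  assumes "f \<in> Homs C a b" "g \<in> Homs C a b"
  shows "diff_arr a b f g \<in> Homs C a b"
proof -
  have ab: "a \<in> Obj C" "b \<in> Obj C" using hom_arr assms by auto
  interpret H: group "Hgrp C a b" using hgrp_group ab .
  show ?thesis using assms unfolding diff_arr_def hgrp_carrier[OF ab, symmetric] by simp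
qed

lemma diff_eq_zero_iff:
  assumes "f \<in> Homs C a b" "g \<in> Homs C a b"
  shows "diff_arr a b f g = zero_arr C a b \<longleftrightarrow> f = g"
proof -
  have ab: "a \<in> Obj C" "b \<in> Obj C" using hom_arr assms by auto
  interpret H: group "Hgrp C a b" using hgrp_group ab .
  show ?thesis using assms H.inv_equality H.inv_inv unfolding diff_arr_def hgrp_carrier[OF ab, symmetric]
    by (metis H.inv_closed H.r_inv)
qed

lemma diff_zero:
  assumes "f \<in> Homs C a b"
  shows "diff_arr a b f (zero_arr C a b) = f"
proof -
  have ab: "a \<in> Obj C" "b \<in> Obj C" using hom_arr assms by auto
  interpret H: group "Hgrp C a b" using hgrp_group ab .
  show ?thesis using assms unfolding diff_arr_def hgrp_carrier[OF ab, symmetric] by simp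
qed

lemma comp_diff:
  assumes "f \<in> Homs C a b" "g \<in> Homs C a b" "h \<in> Homs C b c"
  shows "h \<cdot> diff_arr a b f g = diff_arr a c (h \<cdot> f) (h \<cdot> g)"
proof -
  have ab: "a \<in> Obj C" "b \<in> Obj C" "c \<in> Obj C" using hom_arr assms by auto
  interpret H: group_hom "Hgrp C a b" "Hgrp C a c" "\<lambda>f. h \<cdot> f"
    using hgrp_group ab postcomp_additive[OF ab(1) assms(3)]
    by (simp add: group_hom_def group_hom_axioms_def)
  show ?thesis using assms H.hom_mult H.hom_inv unfolding diff_arr_def hgrp_carrier[OF ab(1,2), symmetric]
    by (simp del: H.hom_mult H.hom_inv)
qed

lemma diff_comp:
  assumes "f \<in> Homs C b c" "g \<in> Homs C b c" "h \<in> Homs C a b"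
  shows "diff_arr b c f g \<cdot> h = diff_arr a c (f \<cdot> h) (g \<cdot> h)"
proof -
  have ab: "b \<in> Obj C" "c \<in> Obj C" "a \<in> Obj C" using hom_arr assms by auto
  interpret H: group_hom "Hgrp C b c" "Hgrp C a c" "\<lambda>f. f \<cdot> h"
    using hgrp_group ab precomp_additive[OF assms(3) ab(2)]
    by (simp add: group_hom_def group_hom_axioms_def)
  show ?thesis using assms H.hom_mult H.hom_inv unfolding diff_arr_def hgrp_carrier[OF ab(1,2), symmetric]
    by (simp del: H.hom_mult H.hom_inv)
qed

lemma monicD:
  assumes "monic C f" "f \<in> Homs C a b" "u \<in> Homs C t a" "v \<in> Homs C t a" "f \<cdot> u = f \<cdot> v"
  shows "u = v"
  using assms hom_arr(2)[OF assms(2)] unfolding monic_def by blast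

lemma epicD:
  assumes "epic C f" "f \<in> Homs C a b" "u \<in> Homs C b t" "v \<in> Homs C b t" "u \<cdot> f = v \<cdot> f"
  shows "u = v"
  using assms hom_arr(3)[OF assms(2)] unfolding epic_def by blast

text \<open>
  As composition is additive, cancellation only has to be tested against the zero arrow. This and
  its dual are the criteria by which arrows are proved monic and epic below.
\<close>

lemma monicI:
  assumes "f \<in> Homs C a b"
    and "\<And>t u. u \<in> Homs C t a \<Longrightarrow> f \<cdot> u = zero_arr C t b \<Longrightarrow> u = zero_arr C t a"
  shows "monic C f"
  unfolding monic_def
proof (intro conjI allI ballI impI)
  show "f \<in> Arr C" using assms hom_arr by blast
  fix t u v assume "u \<in> Homs C t (Dom C f)" "v \<in> Homs C t (Dom C f)" and e: "f \<cdot> u = f \<cdot> v"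
  then have u: "u \<in> Homs C t a" and v: "v \<in> Homs C t a" using hom_arr(2)[OF assms(1)] by auto
  have "f \<cdot> diff_arr t a u v = diff_arr t b (f \<cdot> u) (f \<cdot> v)"
    using comp_diff[OF u v assms(1)] .
  also have "\<dots> = zero_arr C t b" using e diff_eq_zero_iff comp_hom[OF v assms(1)] by simp
  finally show "u = v" using assms(2)[OF diff_hom[OF u v]] diff_eq_zero_iff[OF u v] by simp
qed

lemma epicI:
  assumes "f \<in> Homs C a b"
    and "\<And>t u. u \<in> Homs C b t \<Longrightarrow> u \<cdot> f = zero_arr C a t \<Longrightarrow> u = zero_arr C b t"
  shows "epic C f"
  unfolding epic_def
proof (intro conjI allI ballI impI)
  show "f \<in> Arr C" using assms hom_arr by blast
  fix t u v assume "u \<in> Homs C (Cod C f) t" "v \<in> Homs C (Cod C f) t" and e: "u \<cdot> f = v \<cdot> f"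
  then have u: "u \<in> Homs C b t" and v: "v \<in> Homs C b t" using hom_arr(3)[OF assms(1)] by auto
  have "diff_arr b t u v \<cdot> f = diff_arr a t (u \<cdot> f) (v \<cdot> f)"
    using diff_comp[OF u v assms(1)] .
  also have "\<dots> = zero_arr C a t" using e diff_eq_zero_iff comp_hom[OF assms(1) v] by simp
  finally show "u = v" using assms(2)[OF diff_hom[OF u v]] diff_eq_zero_iff[OF u v] by simp
qed

lemma epic_zero:
  assumes "epic C f" "f \<in> Homs C a b" "u \<in> Homs C b t" "u \<cdot> f = zero_arr C a t"
  shows "u = zero_arr C b t"
  using epicD[OF assms(1-3) zero_hom] zero_comp[OF assms(2)] assms(4) hom_arr assms(2,3) by metis

lemma monic_zero:
  assumes "monic C f" "f \<in> Homs C a b" "u \<in> Homs C t a" "f \<cdot> u = zero_arr C t b"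
  shows "u = zero_arr C t a"
  using monicD[OF assms(1-3) zero_hom] comp_zero[OF assms(2)] assms(4) hom_arr assms(2,3) by metis

lemma epic_comp:
  assumes "epic C f" "epic C g" "f \<in> Homs C a b" "g \<in> Homs C b c"
  shows "epic C (g \<cdot> f)"
proof (rule epicI[OF comp_hom[OF assms(3,4)]])
  fix t u assume u: "u \<in> Homs C c t" and z: "u \<cdot> (g \<cdot> f) = zero_arr C a t"
  then have "(u \<cdot> g) \<cdot> f = zero_arr C a t" using comp_assoc[OF assms(3,4) u] by simp
  then have "u \<cdot> g = zero_arr C b t" using epic_zero[OF assms(1,3) comp_hom[OF assms(4) u]] by simp
  then show "u = zero_arr C c t" using epic_zero[OF assms(2,4) u] by simp
qed

lemma idn_monic: "a \<in> Obj C \<Longrightarrow> monic C (Idn C a)"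
  by (rule monicI[OF idn_hom]) (simp_all add: idn_comp)

lemma idn_epic: "a \<in> Obj C \<Longrightarrow> epic C (Idn C a)"
  by (rule epicI[OF idn_hom]) (simp_all add: comp_idn)

lemma kernelI:
  assumes k: "k \<in> Homs C K A" and f: "f \<in> Homs C A B" and "f \<cdot> k = zero_arr C K B" "monic C k"
    and "\<And>t h. h \<in> Homs C t A \<Longrightarrow> f \<cdot> h = zero_arr C t B \<Longrightarrow> \<exists>u \<in> Homs C t K. k \<cdot> u = h"
  shows "is_kernel C k f"
  unfolding is_kernel_def hom_arr(2,3)[OF k] hom_arr(2,3)[OF f]
  using assms monicD[OF assms(4) k] hom_arr(1)[OF k] hom_arr(1)[OF f] by (metis (lifting))

lemma cokernelI:
  assumes f: "f \<in> Homs C A B" and c: "c \<in> Homs C B Q" and "c \<cdot> f = zero_arr C A Q" "epic C c"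
    and "\<And>t h. h \<in> Homs C B t \<Longrightarrow> h \<cdot> f = zero_arr C A t \<Longrightarrow> \<exists>u \<in> Homs C Q t. u \<cdot> c = h"
  shows "is_cokernel C c f"
  unfolding is_cokernel_def hom_arr(2,3)[OF c] hom_arr(2,3)[OF f]
  using assms epicD[OF assms(4) c] hom_arr(1)[OF c] hom_arr(1)[OF f] by (metis (lifting))

lemma kernel_hom: "is_kernel C k f \<Longrightarrow> f \<in> Homs C A B \<Longrightarrow> k \<in> Homs C (Dom C k) A"
  unfolding is_kernel_def Homs_def by auto

lemma cokernel_hom: "is_cokernel C c f \<Longrightarrow> f \<in> Homs C A B \<Longrightarrow> c \<in> Homs C B (Cod C c)"
  unfolding is_cokernel_def Homs_def by auto

lemma kernel_comp:
  "is_kernel C k f \<Longrightarrow> k \<in> Homs C K A \<Longrightarrow> f \<in> Homs C A B \<Longrightarrow> f \<cdot> k = zero_arr C K B"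
  unfolding is_kernel_def using hom_arr by metis

lemma cokernel_comp:
  "is_cokernel C c f \<Longrightarrow> f \<in> Homs C A B \<Longrightarrow> c \<in> Homs C B Q \<Longrightarrow> c \<cdot> f = zero_arr C A Q"
  unfolding is_cokernel_def using hom_arr by metis

lemma kernel_lift:
  assumes "is_kernel C k f" "k \<in> Homs C K A" "f \<in> Homs C A B" "h \<in> Homs C t A"
    "f \<cdot> h = zero_arr C t B"
  obtains u where "u \<in> Homs C t K" "k \<cdot> u = h"
  using assms hom_arr(2,3)[OF assms(2)] hom_arr(2,3)[OF assms(3)]
  unfolding is_kernel_def by (metis (lifting))

lemma cokernel_desc:
  assumes "is_cokernel C c f" "f \<in> Homs C A B" "c \<in> Homs C B Q" "h \<in> Homs C B t"
    "h \<cdot> f = zero_arr C A t"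
  obtains u where "u \<in> Homs C Q t" "u \<cdot> c = h"
  using assms hom_arr(2,3)[OF assms(2)] hom_arr(2,3)[OF assms(3)]
  unfolding is_cokernel_def by (metis (lifting))

lemma kernel_monic:
  assumes ker: "is_kernel C k f" and k: "k \<in> Homs C K A" and f: "f \<in> Homs C A B"
  shows "monic C k"
proof (rule monicI[OF k])
  fix t u assume u: "u \<in> Homs C t K" and z: "k \<cdot> u = zero_arr C t A"
  have t: "t \<in> Obj C" "K \<in> Obj C" "A \<in> Obj C" using hom_arr u k by auto
  have "f \<cdot> zero_arr C t A = zero_arr C t B" "zero_arr C t A \<in> Homs C t A"
    using comp_zero[OF f] zero_hom t by auto
  then have "\<exists>!u. u \<in> Homs C t K \<and> k \<cdot> u = zero_arr C t A"
    using ker hom_arr(2,3)[OF k] hom_arr(2,3)[OF f] unfolding is_kernel_def by metis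
  moreover have "k \<cdot> zero_arr C t K = zero_arr C t A" "zero_arr C t K \<in> Homs C t K"
    using comp_zero[OF k] zero_hom t by auto
  ultimately show "u = zero_arr C t K" using u z by auto
qed

lemma cokernel_epic:
  assumes cok: "is_cokernel C c f" and f: "f \<in> Homs C A B" and c: "c \<in> Homs C B Q"
  shows "epic C c"
proof (rule epicI[OF c])
  fix t u assume u: "u \<in> Homs C Q t" and z: "u \<cdot> c = zero_arr C B t"
  have t: "t \<in> Obj C" "Q \<in> Obj C" "B \<in> Obj C" using hom_arr u c by auto
  have "zero_arr C B t \<cdot> f = zero_arr C A t" "zero_arr C B t \<in> Homs C B t"
    using zero_comp[OF f] zero_hom t by auto
  then have "\<exists>!u. u \<in> Homs C Q t \<and> u \<cdot> c = zero_arr C B t"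
    using cok hom_arr(2,3)[OF c] hom_arr(2,3)[OF f] unfolding is_cokernel_def by metis
  moreover have "zero_arr C Q t \<cdot> c = zero_arr C B t" "zero_arr C Q t \<in> Homs C Q t"
    using zero_comp[OF c] zero_hom t by auto
  ultimately show "u = zero_arr C Q t" using u z by auto
qed

end

section \<open>Exactness in abelian categories\<close>

context abelian_category
begin

lemma obtain_kernel:
  assumes "f \<in> Homs C A B"
  obtains K k where "k \<in> Homs C K A" "is_kernel C k f"
  using ex_kernel[OF hom_arr(1)[OF assms]] kernel_hom assms by metis

lemma obtain_cokernel:
  assumes "f \<in> Homs C A B"
  obtains Q c where "c \<in> Homs C B Q" "is_cokernel C c f"
  using ex_cokernel[OF hom_arr(1)[OF assms]] cokernel_hom assms by metis

text \<open>
  An epimorphism is the cokernel of some arrow \<open>h\<close>, and \<open>h\<close> factors through the kernel of \<open>g\<close>, so an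
  arrow that kills the kernel also kills \<open>h\<close>.
\<close>

lemma cokernel_of_kernel:
  assumes g: "epic C g" "g \<in> Homs C A M" and k: "is_kernel C k g" "k \<in> Homs C K A"
  shows "is_cokernel C g k"
proof -
  obtain h where h: "is_cokernel C g h" using epic_is_cokernel g by blast
  define B where "B = Dom C h"
  have hh: "h \<in> Homs C B A" using h hom_arr(2)[OF g(2)] unfolding B_def is_cokernel_def Homs_def by auto
  obtain l where l: "l \<in> Homs C B K" "k \<cdot> l = h"
    using kernel_lift[OF k g(2) hh cokernel_comp[OF h hh g(2)]] by blast
  show ?thesis
  proof (rule cokernelI[OF k(2) g(2) kernel_comp[OF k g(2)] g(1)])
    fix t u assume u: "u \<in> Homs C A t" and z: "u \<cdot> k = zero_arr C K t"
    have "u \<cdot> h = (u \<cdot> k) \<cdot> l" using comp_assoc[OF l(1) k(2) u] l by simp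
    also have "\<dots> = zero_arr C B t" using z zero_comp[OF l(1)] hom_arr(5)[OF u] by simp
    finally show "\<exists>v \<in> Homs C M t. v \<cdot> g = u" using cokernel_desc[OF h hh g(2) u] by metis
  qed
qed

lemma kernel_of_cokernel:
  assumes k: "monic C k" "k \<in> Homs C K A" and c: "is_cokernel C c k" "c \<in> Homs C A Q"
  shows "is_kernel C k c"
proof -
  obtain h where h: "is_kernel C k h" using monic_is_kernel k by blast
  define B where "B = Cod C h"
  have hh: "h \<in> Homs C A B" using h hom_arr(3)[OF k(2)] unfolding B_def is_kernel_def Homs_def by auto
  obtain l where l: "l \<in> Homs C Q B" "l \<cdot> c = h"
    using cokernel_desc[OF c(1) k(2) c(2) hh kernel_comp[OF h k(2) hh]] by blast
  show ?thesis
  proof (rule kernelI[OF k(2) c(2) cokernel_comp[OF c(1) k(2) c(2)] k(1)])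
    fix t u assume u: "u \<in> Homs C t A" and z: "c \<cdot> u = zero_arr C t Q"
    have "h \<cdot> u = l \<cdot> (c \<cdot> u)" using comp_assoc[OF u c(2) l(1)] l by simp
    also have "\<dots> = zero_arr C t B" using z comp_zero[OF l(1)] hom_arr(4)[OF u] by simp
    finally show "\<exists>v \<in> Homs C t K. k \<cdot> v = u" using kernel_lift[OF h k(2) hh u] by metis
  qed
qed

lemma monic_comp:
  assumes "monic C f" "monic C g" "f \<in> Homs C a b" "g \<in> Homs C b c"
  shows "monic C (g \<cdot> f)"
proof (rule monicI[OF comp_hom[OF assms(3,4)]])
  fix t u assume u: "u \<in> Homs C t a" and z: "(g \<cdot> f) \<cdot> u = zero_arr C t c"
  then have "g \<cdot> (f \<cdot> u) = zero_arr C t c" using comp_assoc[OF u assms(3,4)] by simp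
  then have "f \<cdot> u = zero_arr C t b" using monic_zero[OF assms(2,4) comp_hom[OF u assms(3)]] by simp
  then show "u = zero_arr C t a" using monic_zero[OF assms(1,3) u] by simp
qed

text \<open>
  If \<open>u\<close> kills \<open>e\<close>, then \<open>f\<close> factors through the subobject \<open>m \<cdot> ker u\<close>, which is itself the kernel of
  its cokernel \<open>h\<close>. Since \<open>h\<close> kills \<open>f\<close>, it kills the image \<open>m\<close>; so \<open>m\<close> factors through \<open>m \<cdot> ker u\<close>, which
  splits the monomorphism \<open>ker u\<close> and forces \<open>u = 0\<close>.
\<close>

lemma image_coimage_epic:
  assumes f: "f \<in> Homs C A B" and c: "is_cokernel C c f" "c \<in> Homs C B Q"
    and m: "is_kernel C m c" "m \<in> Homs C I B" and e: "e \<in> Homs C A I" "m \<cdot> e = f"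
  shows "epic C e"
proof (rule epicI[OF e(1)])
  fix t u assume u: "u \<in> Homs C I t" and z: "u \<cdot> e = zero_arr C A t"
  obtain W w where w: "w \<in> Homs C W I" "is_kernel C w u" using obtain_kernel[OF u] .
  obtain e' where e': "e' \<in> Homs C A W" "w \<cdot> e' = e" using kernel_lift[OF w(2,1) u e(1) z] .
  have mm: "monic C m" using kernel_monic[OF m c(2)] .
  have mw: "monic C (m \<cdot> w)" "m \<cdot> w \<in> Homs C W B"
    using monic_comp[OF kernel_monic[OF w(2,1) u] mm w(1) m(2)] comp_hom[OF w(1) m(2)] by auto
  obtain D h where h: "h \<in> Homs C B D" "is_cokernel C h (m \<cdot> w)" using obtain_cokernel[OF mw(2)] .
  have k: "is_kernel C (m \<cdot> w) h" using kernel_of_cokernel[OF mw h(2,1)] .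
  have "h \<cdot> f = (h \<cdot> (m \<cdot> w)) \<cdot> e'"
    using e e' comp_assoc[OF e'(1) w(1) m(2)] comp_assoc[OF e'(1) mw(2) h(1)] by simp
  also have "\<dots> = zero_arr C A D"
    using zero_comp[OF e'(1) hom_arr(5)[OF h(1)]] cokernel_comp[OF h(2) mw(2) h(1)] by simp
  finally obtain h' where h': "h' \<in> Homs C Q D" "h' \<cdot> c = h"
    using cokernel_desc[OF c(1) f c(2) h(1)] by metis
  have "h \<cdot> m = h' \<cdot> (c \<cdot> m)" using h' comp_assoc[OF m(2) c(2) h'(1)] by simp
  also have "\<dots> = zero_arr C I D"
    using kernel_comp[OF m c(2)] comp_zero[OF h'(1)] hom_arr(4)[OF m(2)] by simp
  finally obtain s where s: "s \<in> Homs C I W" "(m \<cdot> w) \<cdot> s = m"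
    using kernel_lift[OF k mw(2) h(1) m(2)] by metis
  have I: "I \<in> Obj C" using hom_arr m(2) by blast
  have "m \<cdot> (w \<cdot> s) = m \<cdot> Idn C I" using s comp_assoc[OF s(1) w(1) m(2)] comp_idn[OF m(2)] by simp
  then have ws: "w \<cdot> s = Idn C I"
    using monicD[OF mm m(2) comp_hom[OF s(1) w(1)] idn_hom[OF I]] by simp
  have "u = (u \<cdot> w) \<cdot> s" using comp_idn[OF u] ws comp_assoc[OF s(1) w(1) u] by simp
  also have "\<dots> = zero_arr C I t"
    using kernel_comp[OF w(2,1) u] zero_comp[OF s(1)] hom_arr(5)[OF u] by simp
  finally show "u = zero_arr C I t" .
qed

text \<open>
  Images, defined as kernels of cokernels, are the monic parts of epi-mono factorizations.
\<close>

lemma is_image_iff: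
  assumes f: "f \<in> Homs C A B"
  shows "is_image C i f \<longleftrightarrow> monic C i \<and> (\<exists>I e. i \<in> Homs C I B \<and> e \<in> Homs C A I \<and> epic C e \<and> i \<cdot> e = f)"
proof
  assume "is_image C i f"
  then obtain c where c: "is_cokernel C c f" "is_kernel C i c" unfolding is_image_def by blast
  define I Q where "I = Dom C i" and "Q = Cod C c"
  have ch: "c \<in> Homs C B Q" using cokernel_hom[OF c(1) f] Q_def by simp
  have ih: "i \<in> Homs C I B" using kernel_hom[OF c(2) ch] I_def by simp
  obtain e where e: "e \<in> Homs C A I" "i \<cdot> e = f"
    using kernel_lift[OF c(2) ih ch f cokernel_comp[OF c(1) f ch]] .
  show "monic C i \<and> (\<exists>I e. i \<in> Homs C I B \<and> e \<in> Homs C A I \<and> epic C e \<and> i \<cdot> e = f)"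
    using kernel_monic[OF c(2) ih ch] ih e image_coimage_epic[OF f c(1) ch c(2) ih e] by blast
next
  assume "monic C i \<and> (\<exists>I e. i \<in> Homs C I B \<and> e \<in> Homs C A I \<and> epic C e \<and> i \<cdot> e = f)"
  then obtain I e where m: "monic C i" and i: "i \<in> Homs C I B"
    and e: "e \<in> Homs C A I" "epic C e" "i \<cdot> e = f" by blast
  obtain Q c where c: "c \<in> Homs C B Q" "is_cokernel C c i" using obtain_cokernel[OF i] .
  have cf: "c \<cdot> f = (c \<cdot> i) \<cdot> e" using e comp_assoc[OF e(1) i c(1)] by simp
  have "is_cokernel C c f"
  proof (rule cokernelI[OF f c(1)])
    show "c \<cdot> f = zero_arr C A Q"
      using cf cokernel_comp[OF c(2) i c(1)] zero_comp[OF e(1)] hom_arr(5)[OF c(1)] by simp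
    show "epic C c" using cokernel_epic[OF c(2) i c(1)] .
    fix t h assume h: "h \<in> Homs C B t" and z: "h \<cdot> f = zero_arr C A t"
    have "(h \<cdot> i) \<cdot> e = zero_arr C A t" using z e comp_assoc[OF e(1) i h] by simp
    then have "h \<cdot> i = zero_arr C I t" using epic_zero[OF e(2,1) comp_hom[OF i h]] by simp
    then show "\<exists>u\<in>Homs C Q t. u \<cdot> c = h" using cokernel_desc[OF c(2) i c(1) h] by metis
  qed
  then show "is_image C i f" unfolding is_image_def using kernel_of_cokernel[OF m i c(2,1)] by blast
qed

text \<open>
  This form of exactness is the one used from here on: it produces the factorization through the
  syzygy directly.
\<close>

lemma exact_at_iff:
  assumes f: "f \<in> Homs C A B" and g: "g \<in> Homs C B D"
  shows "exact_at C f g \<longleftrightarrow>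
    (\<exists>I i e. i \<in> Homs C I B \<and> is_kernel C i g \<and> e \<in> Homs C A I \<and> epic C e \<and> i \<cdot> e = f)"
  unfolding exact_at_def is_image_iff[OF f] using kernel_monic[OF _ _ g] by blast

lemma null_obj: "zero_object C (null_obj C)"
  unfolding null_obj_def using ex_zero_object by (rule someI_ex)

lemma null_in_Obj: "zero_object C z \<Longrightarrow> z \<in> Obj C"
  unfolding zero_object_def by blast

lemma from_zero_object: "zero_object C z \<Longrightarrow> f \<in> Homs C z a \<Longrightarrow> f = zero_arr C z a"
  using zero_hom[OF null_in_Obj] hom_arr(5) unfolding zero_object_def by metis

lemma to_zero_object: "zero_object C z \<Longrightarrow> f \<in> Homs C a z \<Longrightarrow> f = zero_arr C a z"
  using zero_hom[OF _ null_in_Obj] hom_arr(4) unfolding zero_object_def by metis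

lemma zero_monic: "zero_object C z \<Longrightarrow> f \<in> Homs C z a \<Longrightarrow> monic C f"
  by (rule monicI) (auto intro: to_zero_object)

lemma zero_epic: "zero_object C z \<Longrightarrow> f \<in> Homs C a z \<Longrightarrow> epic C f"
  by (rule epicI) (auto intro: from_zero_object)

lemma kernel_of_monic_is_zero:
  assumes f: "monic C f" "f \<in> Homs C A B" and z: "zero_object C z"
  shows "is_kernel C (zero_arr C z A) f"
proof (rule kernelI[OF zero_hom f(2)])
  have o: "z \<in> Obj C" "A \<in> Obj C" "B \<in> Obj C" using null_in_Obj z hom_arr f by auto
  show "z \<in> Obj C" "A \<in> Obj C" using o by auto
  show "f \<cdot> zero_arr C z A = zero_arr C z B" using comp_zero f o by blast
  show "monic C (zero_arr C z A)" using zero_monic z zero_hom o by blast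
  fix t h assume h: "h \<in> Homs C t A" and z': "f \<cdot> h = zero_arr C t B"
  have t: "t \<in> Obj C" using hom_arr h by blast
  have "zero_arr C z A \<cdot> zero_arr C t z = h"
    using monic_zero[OF f h z'] comp_zero[OF zero_hom] o t by simp
  then show "\<exists>u\<in>Homs C t z. zero_arr C z A \<cdot> u = h" using zero_hom o t by blast
qed

lemma idn_is_kernel_of_zero:
  assumes z: "zero_object C z" and f: "f \<in> Homs C A z"
  shows "is_kernel C (Idn C A) f"
proof (rule kernelI[OF idn_hom f])
  show A: "A \<in> Obj C" using hom_arr f by blast
  show "f \<cdot> Idn C A = zero_arr C A z" using to_zero_object[OF z f] comp_idn[OF f] by simp
  show "monic C (Idn C A)" using idn_monic A .
  fix t h assume h: "h \<in> Homs C t A"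
  then show "\<exists>u\<in>Homs C t A. Idn C A \<cdot> u = h" using idn_comp by blast
qed

lemma monic_if_zero_kernel:
  assumes k: "is_kernel C k f" "k \<in> Homs C K A" "f \<in> Homs C A B" and z: "zero_object C K"
  shows "monic C f"
proof (rule monicI[OF k(3)])
  fix t u assume u: "u \<in> Homs C t A" "f \<cdot> u = zero_arr C t B"
  then obtain v where v: "v \<in> Homs C t K" "k \<cdot> v = u" using kernel_lift[OF k] by blast
  have "v = zero_arr C t K" using to_zero_object z v by blast
  then show "u = zero_arr C t A" using v comp_zero[OF k(2)] hom_arr(4)[OF v(1)] by simp
qed

lemma epic_from_zero_object:
  assumes "zero_object C z" "e \<in> Homs C z M" "epic C e"
  shows "zero_object C M"
proof -
  have M: "M \<in> Obj C" using hom_arr assms by blast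
  have 1: "f = g" if "f \<in> Homs C M a" "g \<in> Homs C M a" for f g a
    using epicD[OF assms(3,2) that] from_zero_object[OF assms(1)] comp_hom[OF assms(2)] that by metis
  have "f = g" if "f \<in> Homs C a M" "g \<in> Homs C a M" for f g a
    using 1[OF idn_hom[OF M] zero_hom[OF M M]] idn_comp that zero_comp M by metis
  then show ?thesis unfolding zero_object_def using M 1 zero_hom[OF M] zero_hom[OF _ M] by blast
qed

text \<open>
  If \<open>f\<close> is exact before \<open>0\<close>, its image \<open>i\<close> is a kernel of an arrow to zero, hence has a right inverse.
\<close>

lemma exact_to_zero_iff:
  assumes f: "f \<in> Homs C A B" and z: "zero_object C z" and g: "g \<in> Homs C B z"
  shows "exact_at C f g \<longleftrightarrow> epic C f"
proof
  assume "epic C f"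
  then show "exact_at C f g"
    unfolding exact_at_iff[OF f g]
    using idn_hom[OF hom_arr(5)[OF f]] idn_is_kernel_of_zero[OF z g] f idn_comp[OF f] by blast
next
  assume "exact_at C f g"
  then obtain I i e where i: "i \<in> Homs C I B" "is_kernel C i g" and e: "e \<in> Homs C A I" "epic C e" "i \<cdot> e = f"
    unfolding exact_at_iff[OF f g] by blast
  have B: "B \<in> Obj C" using hom_arr f by blast
  obtain s where s: "s \<in> Homs C B I" "i \<cdot> s = Idn C B"
    using kernel_lift[OF i(2,1) g idn_hom[OF B]] comp_idn[OF g] to_zero_object[OF z g] by metis
  have "epic C i"
  proof (rule epicI[OF i(1)])
    fix t u assume u: "u \<in> Homs C B t" and zz: "u \<cdot> i = zero_arr C I t"
    have "u = (u \<cdot> i) \<cdot> s" using s comp_assoc[OF s(1) i(1) u] comp_idn[OF u] by simp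
    then show "u = zero_arr C B t" using zz zero_comp[OF s(1)] hom_arr(5)[OF u] by simp
  qed
  then show "epic C f" using epic_comp[OF e(2) _ e(1) i(1)] e by simp
qed

lemma exact_from_zero_iff:
  assumes f: "f \<in> Homs C A B" and z: "zero_object C z" and g: "g \<in> Homs C z A"
  shows "exact_at C g f \<longleftrightarrow> monic C f"
proof
  have zo: "z \<in> Obj C" and A: "A \<in> Obj C" using null_in_Obj z hom_arr f by auto
  assume "monic C f"
  then show "exact_at C g f"
    unfolding exact_at_iff[OF g f]
    using kernel_of_monic_is_zero[OF _ f z] zero_hom[OF zo A] idn_hom[OF zo] idn_epic[OF zo]
      from_zero_object[OF z g] comp_idn[OF g] by metis
next
  assume "exact_at C g f"
  then obtain I i e where i: "i \<in> Homs C I A" "is_kernel C i f" and e: "e \<in> Homs C z I" "epic C e"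
    unfolding exact_at_iff[OF g f] by blast
  show "monic C f" using monic_if_zero_kernel[OF i(2,1) f] epic_from_zero_object[OF z e] .
qed

lemma to_null_hom: "b \<in> Obj C \<Longrightarrow> to_null C b \<in> Homs C b (null_obj C)"
  using zero_hom null_in_Obj null_obj by blast

lemma from_null_hom: "b \<in> Obj C \<Longrightarrow> from_null C b \<in> Homs C (null_obj C) b"
  using zero_hom null_in_Obj null_obj by blast

text \<open>
  The three exactness conditions are traded for a kernel and an epimorphism. In the forward direction
  exactness gives \<open>k = i \<cdot> e\<close> with \<open>i\<close> a kernel of \<open>g\<close> and \<open>e\<close> epic; as \<open>k\<close> is monic so is \<open>e\<close>, and a monic
  epic arrow is invertible because it is the kernel of its (zero) cokernel. Hence \<open>k\<close> is a kernel too.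
\<close>

lemma short_exact_iff:
  "short_exact C K k A g M \<longleftrightarrow> k \<in> Homs C K A \<and> g \<in> Homs C A M \<and> is_kernel C k g \<and> epic C g"
proof (cases "k \<in> Homs C K A \<and> g \<in> Homs C A M")
  case True
  then have k: "k \<in> Homs C K A" and g: "g \<in> Homs C A M" by auto
  have o: "K \<in> Obj C" "M \<in> Obj C" using hom_arr k g by auto
  have *: "monic C k \<and> exact_at C k g \<longleftrightarrow> is_kernel C k g"
  proof
    assume "is_kernel C k g"
    then show "monic C k \<and> exact_at C k g"
      unfolding exact_at_iff[OF k g]
      using kernel_monic[OF _ k g] k idn_hom[OF o(1)] idn_epic[OF o(1)] comp_idn[OF k] by blast
  next
    assume a: "monic C k \<and> exact_at C k g"
    then obtain I i e where i: "i \<in> Homs C I A" "is_kernel C i g" and e: "e \<in> Homs C K I" "epic C e" "i \<cdot> e = k"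
      unfolding exact_at_iff[OF k g] by blast
    have em: "monic C e"
    proof (rule monicI[OF e(1)])
      fix t u assume u: "u \<in> Homs C t K" and z: "e \<cdot> u = zero_arr C t I"
      then have "k \<cdot> u = zero_arr C t A"
        using e comp_assoc[OF u e(1) i(1)] comp_zero[OF i(1)] hom_arr(4)[OF u] by metis
      then show "u = zero_arr C t K" using monic_zero[OF _ k u] a by blast
    qed
    have ek: "is_kernel C e (to_null C I)"
    proof -
      have I: "I \<in> Obj C" using hom_arr i by blast
      have "is_cokernel C (to_null C I) e"
      proof (rule cokernelI[OF e(1) to_null_hom[OF I]])
        show "to_null C I \<cdot> e = zero_arr C K (null_obj C)" using zero_comp[OF e(1) null_in_Obj[OF null_obj]] .
        show "epic C (to_null C I)" using zero_epic[OF null_obj to_null_hom[OF I]] .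
        fix t h assume h: "h \<in> Homs C I t" and z: "h \<cdot> e = zero_arr C K t"
        have "h = zero_arr C I t" using epic_zero[OF e(2,1) h z] .
        moreover have "t \<in> Obj C" using hom_arr h by blast
        ultimately show "\<exists>u\<in>Homs C (null_obj C) t. u \<cdot> to_null C I = h"
          using from_null_hom zero_comp[OF to_null_hom[OF I]] by metis
      qed
      then show ?thesis using kernel_of_cokernel[OF em e(1) _ to_null_hom[OF I]] by blast
    qed
    show "is_kernel C k g"
    proof (rule kernelI[OF k g])
      show "monic C k" using a by blast
      have "g \<cdot> k = (g \<cdot> i) \<cdot> e" using comp_assoc[OF e(1) i(1) g] e by simp
      then show "g \<cdot> k = zero_arr C K M" using kernel_comp[OF i(2,1) g] zero_comp[OF e(1) o(2)] by simp
      fix t h assume h: "h \<in> Homs C t A" and z: "g \<cdot> h = zero_arr C t M"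
      obtain v where v: "v \<in> Homs C t I" "i \<cdot> v = h" using kernel_lift[OF i(2,1) g h z] .
      have I: "I \<in> Obj C" and t: "t \<in> Obj C" using hom_arr i h by auto
      obtain w where w: "w \<in> Homs C t K" "e \<cdot> w = v"
        using kernel_lift[OF ek e(1) to_null_hom[OF I] v(1) zero_comp[OF v(1) null_in_Obj[OF null_obj]]] .
      then show "\<exists>u\<in>Homs C t K. k \<cdot> u = h" using v e comp_assoc[OF w(1) e(1) i(1)] by metis
    qed
  qed
  show ?thesis unfolding short_exact_def
    using * k g exact_to_zero_iff[OF g null_obj to_null_hom[OF o(2)]]
      exact_from_zero_iff[OF k null_obj from_null_hom[OF o(1)]] by blast
next
  case False
  then show ?thesis unfolding short_exact_def by blast
qed

lemma short_exactD:
  assumes "short_exact C K k A g M"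
  shows "k \<in> Homs C K A" "g \<in> Homs C A M" "is_kernel C k g" "epic C g" "monic C k" "is_cokernel C g k"
    "g \<cdot> k = zero_arr C K M" "K \<in> Obj C" "A \<in> Obj C" "M \<in> Obj C"
  using assms hom_arr kernel_monic kernel_comp cokernel_of_kernel unfolding short_exact_iff by metis+

lemma zero_object_projective:
  assumes z: "zero_object C z"
  shows "projective C z"
  unfolding projective_def
proof (intro conjI allI impI)
  show zo: "z \<in> Obj C" using null_in_Obj z .
  fix e f assume "epic C e \<and> f \<in> Homs C z (Cod C e)"
  then have e: "e \<in> Homs C (Dom C e) (Cod C e)" and f: "f \<in> Homs C z (Cod C e)"
    by (auto simp: epic_def Homs_def)
  have "e \<cdot> zero_arr C z (Dom C e) = f" using comp_zero[OF e zo] from_zero_object[OF z f] by simp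
  then show "\<exists>g\<in>Homs C z (Dom C e). e \<cdot> g = f" using zero_hom[OF zo hom_arr(4)[OF e]] by blast
qed

lemma exact_at_comp_zero:
  assumes "exact_at C f g" "f \<in> Homs C A B" "g \<in> Homs C B D"
  shows "g \<cdot> f = zero_arr C A D"
proof -
  obtain I i e where i: "i \<in> Homs C I B" "is_kernel C i g" "e \<in> Homs C A I" "i \<cdot> e = f"
    using assms(1) unfolding exact_at_iff[OF assms(2,3)] by blast
  then show ?thesis
    using comp_assoc[OF i(3,1) assms(3)] kernel_comp[OF i(2,1) assms(3)] zero_comp[OF i(3) hom_arr(5)[OF assms(3)]] by simp
qed

end

section \<open>Pulling back short exact sequences\<close>

context abelian_category
begin

text \<open>
  Of the biproduct equations only their consequence is needed: pairing of arrows, uniquely determined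
  by the two components.
\<close>

lemma obtain_product:
  assumes a: "a \<in> Obj C" and b: "b \<in> Obj C"
  obtains i1 s i2 p1 p2 where
    "i1 \<in> Homs C a s" "i2 \<in> Homs C b s" "p1 \<in> Homs C s a" "p2 \<in> Homs C s b"
    "p1 \<cdot> i1 = Idn C a" "p2 \<cdot> i2 = Idn C b" "p1 \<cdot> i2 = zero_arr C b a" "p2 \<cdot> i1 = zero_arr C a b"
    "\<forall>t. \<forall>f \<in> Homs C t a. \<forall>g \<in> Homs C t b. \<exists>h \<in> Homs C t s. p1 \<cdot> h = f \<and> p2 \<cdot> h = g"
    "\<forall>t. \<forall>h \<in> Homs C t s. \<forall>h' \<in> Homs C t s. p1 \<cdot> h = p1 \<cdot> h' \<longrightarrow> p2 \<cdot> h = p2 \<cdot> h' \<longrightarrow> h = h'"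
proof -
  obtain s i1 i2 p1 p2 where s: "s \<in> Obj C"
    and h: "i1 \<in> Homs C a s" "i2 \<in> Homs C b s" "p1 \<in> Homs C s a" "p2 \<in> Homs C s b"
    and e: "p1 \<cdot> i1 = Idn C a" "p2 \<cdot> i2 = Idn C b" "p1 \<cdot> i2 = zero_arr C b a" "p2 \<cdot> i1 = zero_arr C a b"
    and sum: "(i1 \<cdot> p1) \<otimes>\<^bsub>Hgrp C s s\<^esub> (i2 \<cdot> p2) = Idn C s"
    using ex_biproduct[OF a b] unfolding has_biproduct_def by blast
  have split: "u = (i1 \<cdot> (p1 \<cdot> u)) \<otimes>\<^bsub>Hgrp C t s\<^esub> (i2 \<cdot> (p2 \<cdot> u))" if u: "u \<in> Homs C t s" for t u
  proof -
    have "u = ((i1 \<cdot> p1) \<otimes>\<^bsub>Hgrp C s s\<^esub> (i2 \<cdot> p2)) \<cdot> u" using sum idn_comp[OF u] by simp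
    also have "\<dots> = ((i1 \<cdot> p1) \<cdot> u) \<otimes>\<^bsub>Hgrp C t s\<^esub> ((i2 \<cdot> p2) \<cdot> u)"
      using hom_mult[OF precomp_additive[OF u s]] hgrp_carrier[OF s s]
        comp_hom[OF h(3,1)] comp_hom[OF h(4,2)] by simp
    finally show ?thesis using comp_assoc[OF u h(3,1)] comp_assoc[OF u h(4,2)] by simp
  qed
  show ?thesis
  proof (rule that[OF h e]; intro allI ballI impI)
    fix t f g assume f: "f \<in> Homs C t a" and g: "g \<in> Homs C t b"
    have t: "t \<in> Obj C" using hom_arr f by blast
    let ?h = "(i1 \<cdot> f) \<otimes>\<^bsub>Hgrp C t s\<^esub> (i2 \<cdot> g)"
    note k = comp_hom[OF f h(1)] comp_hom[OF g h(2)]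
    interpret S: group "Hgrp C t s" using hgrp_group t s .
    interpret A: group "Hgrp C t a" using hgrp_group t a .
    interpret B: group "Hgrp C t b" using hgrp_group t b .
    have "?h \<in> Homs C t s" using k S.m_closed hgrp_carrier[OF t s] by simp
    moreover have "p1 \<cdot> ?h = (p1 \<cdot> (i1 \<cdot> f)) \<otimes>\<^bsub>Hgrp C t a\<^esub> (p1 \<cdot> (i2 \<cdot> g))"
      using hom_mult[OF postcomp_additive[OF t h(3)]] hgrp_carrier[OF t s] k by simp
    then have "p1 \<cdot> ?h = f"
      using comp_assoc[OF f h(1,3)] comp_assoc[OF g h(2,3)] e idn_comp[OF f] zero_comp[OF g a]
        A.r_one hgrp_carrier[OF t a] f by simp
    moreover have "p2 \<cdot> ?h = (p2 \<cdot> (i1 \<cdot> f)) \<otimes>\<^bsub>Hgrp C t b\<^esub> (p2 \<cdot> (i2 \<cdot> g))"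
      using hom_mult[OF postcomp_additive[OF t h(4)]] hgrp_carrier[OF t s] k by simp
    then have "p2 \<cdot> ?h = g"
      using comp_assoc[OF f h(1,4)] comp_assoc[OF g h(2,4)] e idn_comp[OF g] zero_comp[OF f b]
        B.l_one hgrp_carrier[OF t b] g by simp
    ultimately show "\<exists>h \<in> Homs C t s. p1 \<cdot> h = f \<and> p2 \<cdot> h = g" by blast
  next
    fix t u v assume "u \<in> Homs C t s" "v \<in> Homs C t s" "p1 \<cdot> u = p1 \<cdot> v" "p2 \<cdot> u = p2 \<cdot> v"
    then show "u = v" using split by metis
  qed
qed

text \<open>
  The pullback is the kernel of \<open>d = f \<cdot> p1 - g \<cdot> p2\<close> on \<open>A \<oplus> W\<close>. Pullbacks preserve epimorphisms: \<open>d\<close> is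
  epic since \<open>d \<cdot> i2 = - g\<close> is, so \<open>d\<close> is the cokernel of its kernel \<open>b\<close>. An arrow \<open>u\<close> that kills \<open>p1 \<cdot> b\<close>
  thus yields \<open>u \<cdot> p1 = v \<cdot> d\<close>, and composing with \<open>i2\<close> shows \<open>v = 0\<close>, hence \<open>u = 0\<close>.
\<close>

lemma obtain_pullback:
  assumes f: "f \<in> Homs C A M" and g: "g \<in> Homs C W M" and epi: "epic C g"
  obtains p B q where "p \<in> Homs C B A" "q \<in> Homs C B W" "f \<cdot> p = g \<cdot> q" "epic C p"
    "\<forall>t. \<forall>u \<in> Homs C t A. \<forall>v \<in> Homs C t W. f \<cdot> u = g \<cdot> v \<longrightarrow>
      (\<exists>w \<in> Homs C t B. p \<cdot> w = u \<and> q \<cdot> w = v)"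
    "\<forall>t. \<forall>w \<in> Homs C t B. \<forall>w' \<in> Homs C t B. p \<cdot> w = p \<cdot> w' \<longrightarrow> q \<cdot> w = q \<cdot> w' \<longrightarrow> w = w'"
proof -
  have o: "A \<in> Obj C" "W \<in> Obj C" "M \<in> Obj C" using hom_arr f g by auto
  obtain i1 s i2 p1 p2 where h:
    "i1 \<in> Homs C A s" "i2 \<in> Homs C W s" "p1 \<in> Homs C s A" "p2 \<in> Homs C s W"
    and e: "p1 \<cdot> i1 = Idn C A" "p2 \<cdot> i2 = Idn C W" "p1 \<cdot> i2 = zero_arr C W A" "p2 \<cdot> i1 = zero_arr C A W"
    and pair0: "\<forall>t. \<forall>f \<in> Homs C t A. \<forall>g \<in> Homs C t W. \<exists>h \<in> Homs C t s. p1 \<cdot> h = f \<and> p2 \<cdot> h = g"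
    and joint0: "\<forall>t. \<forall>h \<in> Homs C t s. \<forall>h' \<in> Homs C t s. p1 \<cdot> h = p1 \<cdot> h' \<longrightarrow> p2 \<cdot> h = p2 \<cdot> h' \<longrightarrow> h = h'"
    using obtain_product[OF o(1,2)] .
  note pair = pair0[rule_format] and joint = joint0[rule_format]
  define d where "d = diff_arr s M (f \<cdot> p1) (g \<cdot> p2)"
  note fp = comp_hom[OF h(3) f] and gp = comp_hom[OF h(4) g]
  have d: "d \<in> Homs C s M" unfolding d_def using diff_hom[OF fp gp] .
  have dc: "d \<cdot> u = diff_arr t M (f \<cdot> (p1 \<cdot> u)) (g \<cdot> (p2 \<cdot> u))" if "u \<in> Homs C t s" for t u
    unfolding d_def using diff_comp[OF fp gp that] comp_assoc[OF that h(3) f] comp_assoc[OF that h(4) g]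
    by simp
  have dz: "d \<cdot> u = zero_arr C t M \<longleftrightarrow> f \<cdot> (p1 \<cdot> u) = g \<cdot> (p2 \<cdot> u)" if u: "u \<in> Homs C t s" for t u
    unfolding dc[OF u]
    using diff_eq_zero_iff[OF comp_hom[OF comp_hom[OF u h(3)] f] comp_hom[OF comp_hom[OF u h(4)] g]] .
  have zero_if: "u = zero_arr C M t" if u: "u \<in> Homs C M t" and z: "u \<cdot> (d \<cdot> i2) = zero_arr C W t" for t u
  proof -
    have t: "t \<in> Obj C" using hom_arr u by blast
    have "d \<cdot> i2 = diff_arr W M (zero_arr C W M) g"
      using dc[OF h(2)] e comp_zero[OF f o(2)] comp_idn[OF g] by simp
    then have "diff_arr W t (zero_arr C W t) (u \<cdot> g) = zero_arr C W t"
      using z comp_diff[OF zero_hom[OF o(2,3)] g u] comp_zero[OF u o(2)] by simp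
    then have "u \<cdot> g = zero_arr C W t"
      using diff_eq_zero_iff[OF zero_hom[OF o(2) t] comp_hom[OF g u]] by simp
    then show ?thesis using epic_zero[OF epi g u] by simp
  qed
  have depi: "epic C d"
  proof (rule epicI[OF d])
    fix t u assume u: "u \<in> Homs C M t" and z: "u \<cdot> d = zero_arr C s t"
    have "u \<cdot> (d \<cdot> i2) = zero_arr C W t"
      using z comp_assoc[OF h(2) d u] zero_comp[OF h(2)] hom_arr(5)[OF u] by simp
    then show "u = zero_arr C M t" using zero_if u by blast
  qed
  obtain B b where b: "b \<in> Homs C B s" "is_kernel C b d" using obtain_kernel[OF d] .
  have bm: "monic C b" using kernel_monic[OF b(2,1) d] .
  have cok: "is_cokernel C d b" using cokernel_of_kernel[OF depi d b(2,1)] .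
  show ?thesis
  proof (rule that[of "p1 \<cdot> b" B "p2 \<cdot> b"])
    show p: "p1 \<cdot> b \<in> Homs C B A" and q: "p2 \<cdot> b \<in> Homs C B W" using comp_hom b h by blast+
    show "f \<cdot> (p1 \<cdot> b) = g \<cdot> (p2 \<cdot> b)" using dz[OF b(1)] kernel_comp[OF b(2,1) d] by blast
    show "epic C (p1 \<cdot> b)"
    proof (rule epicI[OF p])
      fix t u assume u: "u \<in> Homs C A t" and z: "u \<cdot> (p1 \<cdot> b) = zero_arr C B t"
      have t: "t \<in> Obj C" using hom_arr u by blast
      have "(u \<cdot> p1) \<cdot> b = zero_arr C B t" using z comp_assoc[OF b(1) h(3) u] by simp
      then obtain v where v: "v \<in> Homs C M t" "v \<cdot> d = u \<cdot> p1"
        using cokernel_desc[OF cok b(1) d comp_hom[OF h(3) u]] by blast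
      have "v \<cdot> (d \<cdot> i2) = u \<cdot> (p1 \<cdot> i2)" using v comp_assoc[OF h(2) d v(1)] comp_assoc[OF h(2,3) u] by simp
      also have "\<dots> = zero_arr C W t" using e comp_zero[OF u o(2)] by simp
      finally have "v = zero_arr C M t" using zero_if v by blast
      then have "u \<cdot> p1 = zero_arr C s t" using v zero_comp[OF d t] by simp
      then have "u \<cdot> (p1 \<cdot> i1) = zero_arr C A t" using comp_assoc[OF h(1,3) u] zero_comp[OF h(1) t] by simp
      then show "u = zero_arr C A t" using e comp_idn[OF u] by simp
    qed
    have ex: "\<exists>w\<in>Homs C t B. p1 \<cdot> b \<cdot> w = u \<and> p2 \<cdot> b \<cdot> w = v"
      if u: "u \<in> Homs C t A" and v: "v \<in> Homs C t W" and uv: "f \<cdot> u = g \<cdot> v" for t u v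
    proof -
      obtain x where x: "x \<in> Homs C t s" "p1 \<cdot> x = u" "p2 \<cdot> x = v" using pair[OF u v] by blast
      have "d \<cdot> x = zero_arr C t M" using dz[OF x(1)] x uv by simp
      then obtain w where "w \<in> Homs C t B" "b \<cdot> w = x" using kernel_lift[OF b(2,1) d x(1)] by blast
      then show ?thesis using x comp_assoc[OF _ b(1) h(3)] comp_assoc[OF _ b(1) h(4)] by metis
    qed
    have un: "w = w'" if w: "w \<in> Homs C t B" "w' \<in> Homs C t B"
      and e: "p1 \<cdot> b \<cdot> w = p1 \<cdot> b \<cdot> w'" "p2 \<cdot> b \<cdot> w = p2 \<cdot> b \<cdot> w'" for t w w'
    proof -
      have "b \<cdot> w = b \<cdot> w'"
        using joint[OF comp_hom[OF w(1) b(1)] comp_hom[OF w(2) b(1)]] e comp_assoc[OF w(1) b(1)] comp_assoc[OF w(2) b(1)] h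
        by metis
      then show ?thesis using monicD[OF bm b(1) w] by blast
    qed
    show "\<forall>t. \<forall>u \<in> Homs C t A. \<forall>v \<in> Homs C t W. f \<cdot> u = g \<cdot> v \<longrightarrow>
      (\<exists>w \<in> Homs C t B. p1 \<cdot> b \<cdot> w = u \<and> p2 \<cdot> b \<cdot> w = v)" using ex by blast
    show "\<forall>t. \<forall>w \<in> Homs C t B. \<forall>w' \<in> Homs C t B.
      p1 \<cdot> b \<cdot> w = p1 \<cdot> b \<cdot> w' \<longrightarrow> p2 \<cdot> b \<cdot> w = p2 \<cdot> b \<cdot> w' \<longrightarrow> w = w'" using un by blast
  qed
qed

text \<open>
  A pullback along \<open>f\<close> of the epimorphism \<open>g\<close> has the same kernel as \<open>g\<close>. The last two conclusions are
  the cases in which \<open>f\<close> is epic, so that the situation is symmetric, and in which \<open>f\<close> is a kernel of \<open>n\<close>,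
  so that its pullback is a kernel of the composite \<open>n \<cdot> g\<close>.
\<close>

lemma pullback_short_exact:
  assumes se: "short_exact C K k W g M" and f: "f \<in> Homs C A M"
  obtains j B p q where "short_exact C K j B p A" "q \<in> Homs C B W" "q \<cdot> j = k" "f \<cdot> p = g \<cdot> q"
    "\<forall>L l. short_exact C L l A f M \<longrightarrow> (\<exists>l'. short_exact C L l' B q W \<and> p \<cdot> l' = l)"
    "\<forall>N n. is_kernel C f n \<longrightarrow> n \<in> Homs C M N \<longrightarrow> is_kernel C q (n \<cdot> g)"
proof -
  note s = short_exactD[OF se]
  obtain p B q where pB: "p \<in> Homs C B A" and q: "q \<in> Homs C B W" and c: "f \<cdot> p = g \<cdot> q" and pE: "epic C p"
    and ex0: "\<forall>t. \<forall>u \<in> Homs C t A. \<forall>v \<in> Homs C t W. f \<cdot> u = g \<cdot> v \<longrightarrow>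
      (\<exists>w \<in> Homs C t B. p \<cdot> w = u \<and> q \<cdot> w = v)"
    and un0: "\<forall>t. \<forall>w \<in> Homs C t B. \<forall>w' \<in> Homs C t B. p \<cdot> w = p \<cdot> w' \<longrightarrow> q \<cdot> w = q \<cdot> w' \<longrightarrow> w = w'"
    using obtain_pullback[OF f s(2,4)] .
  note ex = ex0[rule_format] and un = un0[rule_format]
  note p = pB pE
  have o: "A \<in> Obj C" using hom_arr f by blast
  obtain j where j: "j \<in> Homs C K B" "p \<cdot> j = zero_arr C K A" "q \<cdot> j = k"
    using ex[OF zero_hom[OF s(8) o] s(1)] comp_zero[OF f s(8)] s(7) by auto
  have "monic C j"
  proof (rule monicI[OF j(1)])
    fix t u assume u: "u \<in> Homs C t K" and z: "j \<cdot> u = zero_arr C t B"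
    have "k \<cdot> u = zero_arr C t W"
      using comp_assoc[OF u j(1) q] j z comp_zero[OF q] hom_arr(4)[OF u] by simp
    then show "u = zero_arr C t K" using monic_zero[OF s(5,1) u] by simp
  qed
  then have "is_kernel C j p"
  proof (rule kernelI[OF j(1) p(1) j(2)])
    fix t h assume h: "h \<in> Homs C t B" and z: "p \<cdot> h = zero_arr C t A"
    have t: "t \<in> Obj C" using hom_arr h by blast
    have "g \<cdot> (q \<cdot> h) = zero_arr C t M"
      using c comp_assoc[OF h q s(2)] comp_assoc[OF h p(1) f] z comp_zero[OF f t] by simp
    then obtain u where u: "u \<in> Homs C t K" "k \<cdot> u = q \<cdot> h"
      using kernel_lift[OF s(3,1,2) comp_hom[OF h q]] by blast
    have "j \<cdot> u = h"
    proof (rule un[OF comp_hom[OF u(1) j(1)] h])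
      show "p \<cdot> (j \<cdot> u) = p \<cdot> h" using comp_assoc[OF u(1) j(1) p(1)] j z zero_comp[OF u(1) o] by simp
      show "q \<cdot> (j \<cdot> u) = q \<cdot> h" using comp_assoc[OF u(1) j(1) q] j u by simp
    qed
    then show "\<exists>u\<in>Homs C t K. j \<cdot> u = h" using u by blast
  qed
  then have sB: "short_exact C K j B p A" unfolding short_exact_iff using j p by blast
  have other: "\<exists>l'. short_exact C L l' B q W \<and> p \<cdot> l' = l" if L: "short_exact C L l A f M" for L l
  proof -
    note r = short_exactD[OF L]
    obtain l' where l': "l' \<in> Homs C L B" "p \<cdot> l' = l" "q \<cdot> l' = zero_arr C L W"
      using ex[OF r(1) zero_hom[OF r(8) s(9)]] comp_zero[OF s(2) r(8)] r(7) by auto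
    have "monic C l'"
    proof (rule monicI[OF l'(1)])
      fix t u assume u: "u \<in> Homs C t L" and z: "l' \<cdot> u = zero_arr C t B"
      have "l \<cdot> u = zero_arr C t A"
        using comp_assoc[OF u l'(1) p(1)] l' z comp_zero[OF p(1)] hom_arr(4)[OF u] by simp
      then show "u = zero_arr C t L" using monic_zero[OF r(5,1) u] by simp
    qed
    then have "is_kernel C l' q"
    proof (rule kernelI[OF l'(1) q l'(3)])
      fix t h assume h: "h \<in> Homs C t B" and z: "q \<cdot> h = zero_arr C t W"
      have t: "t \<in> Obj C" using hom_arr h by blast
      have "f \<cdot> (p \<cdot> h) = zero_arr C t M"
        using c comp_assoc[OF h q s(2)] comp_assoc[OF h p(1) f] z comp_zero[OF s(2) t] by simp
      then obtain u where u: "u \<in> Homs C t L" "l \<cdot> u = p \<cdot> h"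
        using kernel_lift[OF r(3,1,2) comp_hom[OF h p(1)]] by blast
      have "l' \<cdot> u = h"
      proof (rule un[OF comp_hom[OF u(1) l'(1)] h])
        show "q \<cdot> (l' \<cdot> u) = q \<cdot> h" using comp_assoc[OF u(1) l'(1) q] l' z zero_comp[OF u(1) s(9)] by simp
        show "p \<cdot> (l' \<cdot> u) = p \<cdot> h" using comp_assoc[OF u(1) l'(1) p(1)] l' u by simp
      qed
      then show "\<exists>u\<in>Homs C t L. l' \<cdot> u = h" using u by blast
    qed
    moreover have "epic C q"
    proof (rule epicI[OF q])
      fix t u assume u: "u \<in> Homs C W t" and z: "u \<cdot> q = zero_arr C B t"
      have t: "t \<in> Obj C" using hom_arr u by blast
      have "u \<cdot> k = (u \<cdot> q) \<cdot> j" using comp_assoc[OF j(1) q u] j by simp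
      also have "\<dots> = zero_arr C K t" using z zero_comp[OF j(1) t] by simp
      finally obtain v where v: "v \<in> Homs C M t" "v \<cdot> g = u" using cokernel_desc[OF s(6,1,2) u] by blast
      have "(v \<cdot> f) \<cdot> p = (v \<cdot> g) \<cdot> q"
        using comp_assoc[OF p(1) f v(1)] comp_assoc[OF q s(2) v(1)] c by simp
      then have "(v \<cdot> f) \<cdot> p = zero_arr C B t" using v z by simp
      then have "v \<cdot> f = zero_arr C A t" using epic_zero[OF p(2,1) comp_hom[OF f v(1)]] by blast
      then have "v = zero_arr C M t" using epic_zero[OF r(4) f v(1)] by blast
      then show "u = zero_arr C W t" using v zero_comp[OF s(2) t] by simp
    qed
    ultimately show ?thesis unfolding short_exact_iff using l' q by blast
  qed
  have sub: "is_kernel C q (n \<cdot> g)" if ker: "is_kernel C f n" and n: "n \<in> Homs C M N" for N n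
  proof -
    have N: "N \<in> Obj C" using hom_arr n by blast
    have fm: "monic C f" using kernel_monic[OF ker f n] .
    show ?thesis
    proof (rule kernelI[OF q comp_hom[OF s(2) n]])
      have "(n \<cdot> g) \<cdot> q = (n \<cdot> f) \<cdot> p" using comp_assoc[OF q s(2) n] comp_assoc[OF p(1) f n] c by simp
      then show "(n \<cdot> g) \<cdot> q = zero_arr C B N" using kernel_comp[OF ker f n] zero_comp[OF p(1) N] by simp
      show "monic C q"
      proof (rule monicI[OF q])
        fix t u assume u: "u \<in> Homs C t B" and z: "q \<cdot> u = zero_arr C t W"
        have t: "t \<in> Obj C" "B \<in> Obj C" using hom_arr u by auto
        have "f \<cdot> (p \<cdot> u) = zero_arr C t M"
          using c comp_assoc[OF u q s(2)] comp_assoc[OF u p(1) f] z comp_zero[OF s(2) t(1)] by simp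
        then have "p \<cdot> u = zero_arr C t A" using monic_zero[OF fm f comp_hom[OF u p(1)]] by blast
        then show "u = zero_arr C t B"
          using un[OF u zero_hom[OF t]] z comp_zero[OF p(1) t(1)] comp_zero[OF q t(1)] by simp
      qed
      fix t h assume h: "h \<in> Homs C t W" and z: "(n \<cdot> g) \<cdot> h = zero_arr C t N"
      obtain v where "v \<in> Homs C t A" "f \<cdot> v = g \<cdot> h"
        using kernel_lift[OF ker f n comp_hom[OF h s(2)]] z comp_assoc[OF h s(2) n] by metis
      then show "\<exists>u\<in>Homs C t B. q \<cdot> u = h" using ex h by blast
    qed
  qed
  show ?thesis using that[OF sB q j(3) c] other sub by blast
qed

lemma short_exact_pullback:
  assumes "short_exact C K k A f M" "short_exact C L l W g M"
  obtains B j p i q where "short_exact C K j B q W" "short_exact C L i B p A" "p \<cdot> j = k" "q \<cdot> i = l" "f \<cdot> p = g \<cdot> q"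
proof -
  note s = short_exactD[OF assms(1)]
  obtain j B p q where sB: "short_exact C L j B p A" "q \<in> Homs C B W" "q \<cdot> j = l" "f \<cdot> p = g \<cdot> q"
    and o: "\<forall>L l. short_exact C L l A f M \<longrightarrow> (\<exists>l'. short_exact C L l' B q W \<and> p \<cdot> l' = l)"
    and "\<forall>N n. is_kernel C f n \<longrightarrow> n \<in> Homs C M N \<longrightarrow> is_kernel C q (n \<cdot> g)"
    using pullback_short_exact[OF assms(2) s(2)] .
  obtain i where i: "short_exact C K i B q W" "p \<cdot> i = k" using o assms(1) by blast
  show ?thesis by (rule that[OF i(1) sB(1) i(2) sB(3,4)])
qed

text \<open>
  The third isomorphism theorem: the kernel \<open>W\<close> of the composite epimorphism is the pullback of \<open>X\<close>
  along \<open>g\<close>, an extension of \<open>X\<close> by the kernel of \<open>g\<close>.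
\<close>

lemma short_exact_composite:
  assumes "short_exact C L l P g Y" "short_exact C X x Y z Z"
  obtains W l' w u where "short_exact C L l' W u X" "short_exact C W w P (z \<cdot> g) Z" "w \<cdot> l' = l" "g \<cdot> w = x \<cdot> u"
proof -
  note r = short_exactD[OF assms(1)] and s = short_exactD[OF assms(2)]
  obtain j B p q where sB: "short_exact C L j B p X" "q \<in> Homs C B P" "q \<cdot> j = l" "x \<cdot> p = g \<cdot> q"
    and "\<forall>L l. short_exact C L l X x Y \<longrightarrow> (\<exists>l'. short_exact C L l' B q P \<and> p \<cdot> l' = l)"
    and o: "\<forall>N n. is_kernel C x n \<longrightarrow> n \<in> Homs C Y N \<longrightarrow> is_kernel C q (n \<cdot> g)"
    using pullback_short_exact[OF assms(1) s(1)] .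
  have W: "short_exact C B q P (z \<cdot> g) Z" unfolding short_exact_iff
    using sB(2) comp_hom[OF r(2) s(2)] o s(3,2) epic_comp[OF r(4) s(4) r(2) s(2)] by blast
  show ?thesis by (rule that[OF sB(1) W sB(3)]) (simp add: sB(4))
qed

end

section \<open>Vanishing of Ext by extension of arrows\<close>

text \<open>
  \<open>ext_vanishes C N j M\<close> stands for \<open>Ext\<^sup>j\<^sup>+\<^sup>1(M, N) = 0\<close>; the index is shifted because the
  recursion starts at \<open>Ext\<^sup>1\<close>. Quantifying over all short exact sequences and all projective
  presentations makes the notion independent of choices by definition, and leaves it to be shown that
  one presentation suffices.
\<close>

primrec ext_vanishes :: "('o, 'm, 'x) precategory_scheme \<Rightarrow> 'o \<Rightarrow> nat \<Rightarrow> 'o \<Rightarrow> bool" where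
  "ext_vanishes C N 0 M \<longleftrightarrow> (\<forall>K k A g. short_exact C K k A g M \<longrightarrow>
    (\<forall>h \<in> Homs C K N. \<exists>h' \<in> Homs C A N. h' \<cdot>\<^bsub>C\<^esub> k = h))"
| "ext_vanishes C N (Suc j) M \<longleftrightarrow> (\<forall>K k P g. short_exact C K k P g M \<and> projective C P \<longrightarrow>
    ext_vanishes C N j K)"

context abelian_category
begin

lemma ext_vanishes_0_extend:
  assumes "ext_vanishes C N 0 M" "short_exact C K k A g M" "h \<in> Homs C K N"
  obtains h' where "h' \<in> Homs C A N" "h' \<cdot> k = h"
  using assms unfolding ext_vanishes.simps by metis

text \<open>
  The exact sequence \<open>Hom(W, N) \<rightarrow> Hom(L, N) \<rightarrow> Ext\<^sup>1(X, N) \<rightarrow> Ext\<^sup>1(W, N) = 0\<close> reduces the vanishing of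
  \<open>Ext\<^sup>1(X, N)\<close> to the single sequence \<open>s\<close>. Given another sequence \<open>0 \<rightarrow> K \<rightarrow> A \<rightarrow> X \<rightarrow> 0\<close> and \<open>h : K \<rightarrow> N\<close>,
  extend \<open>h\<close> to the pullback \<open>B\<close> of \<open>A\<close> and \<open>W\<close>, and correct this extension by an arrow from \<open>W\<close> so that
  it vanishes on \<open>L\<close> and descends to \<open>A\<close>.
\<close>

lemma ext_vanishes_0_if_extension_along_acyclic_cover:
  assumes s: "short_exact C L l W g X" and W: "ext_vanishes C N 0 W"
    and test: "\<And>h. h \<in> Homs C L N \<Longrightarrow> \<exists>h' \<in> Homs C W N. h' \<cdot> l = h"
  shows "ext_vanishes C N 0 X"
  unfolding ext_vanishes.simps
proof (intro allI impI ballI)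
  fix K k A f h assume t: "short_exact C K k A f X" and h: "h \<in> Homs C K N"
  obtain B j p i q where j: "short_exact C K j B q W" and i: "short_exact C L i B p A"
    and c: "p \<cdot> j = k" "q \<cdot> i = l" "f \<cdot> p = g \<cdot> q"
    using short_exact_pullback[OF t s] .
  note jD = short_exactD[OF j] and iD = short_exactD[OF i]
  obtain u where u: "u \<in> Homs C B N" "u \<cdot> j = h" using ext_vanishes_0_extend[OF W j h] .
  obtain v where v: "v \<in> Homs C W N" "v \<cdot> l = u \<cdot> i" using test[OF comp_hom[OF iD(1) u(1)]] by blast
  note vq = comp_hom[OF jD(2) v(1)]
  \<comment> \<open>\<open>u\<close> and \<open>v \<cdot> q\<close> agree on \<open>L\<close>, and \<open>v \<cdot> q\<close> vanishes on \<open>K\<close>, so their difference descends to an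
    extension of \<open>h\<close>.\<close>
  let ?d = "diff_arr B N u (v \<cdot> q)"
  have d: "?d \<in> Homs C B N" using diff_hom[OF u(1) vq] .
  have N: "N \<in> Obj C" using hom_arr h by blast
  have "?d \<cdot> i = diff_arr L N (u \<cdot> i) (v \<cdot> l)"
    using diff_comp[OF u(1) vq iD(1)] comp_assoc[OF iD(1) jD(2) v(1)] c by simp
  then have "?d \<cdot> i = zero_arr C L N"
    using v diff_eq_zero_iff[OF comp_hom[OF iD(1) u(1)] comp_hom[OF iD(1) u(1)]] by simp
  then obtain w where w: "w \<in> Homs C A N" "w \<cdot> p = ?d" using cokernel_desc[OF iD(6,1,2) d] by blast
  have "w \<cdot> k = ?d \<cdot> j" using w c comp_assoc[OF jD(1) iD(2) w(1)] by simp
  also have "\<dots> = diff_arr K N h (v \<cdot> (q \<cdot> j))"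
    using diff_comp[OF u(1) vq jD(1)] comp_assoc[OF jD(1,2) v(1)] u by simp
  also have "\<dots> = h" using jD(7) comp_zero[OF v(1) jD(8)] diff_zero[OF h] by simp
  finally show "\<exists>h' \<in> Homs C A N. h' \<cdot> k = h" using w by blast
qed

lemma projective_lift:
  assumes "projective C P" "epic C e" "e \<in> Homs C A B" "f \<in> Homs C P B"
  obtains g where "g \<in> Homs C P A" "e \<cdot> g = f"
  using assms hom_arr(2,3)[OF assms(3)] unfolding projective_def by metis

text \<open>
  With \<open>t\<close> a section of \<open>g\<close>, the arrow \<open>1 - t \<cdot> g\<close> factors through the kernel and gives the retraction.
\<close>

lemma short_exact_onto_projective_splits:
  assumes "short_exact C K k A g P" "projective C P"
  obtains r where "r \<in> Homs C A K" "r \<cdot> k = Idn C K"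
proof -
  note s = short_exactD[OF assms(1)]
  note iP = idn_hom[OF s(10)] and iA = idn_hom[OF s(9)] and iK = idn_hom[OF s(8)]
  obtain t where t: "t \<in> Homs C P A" "g \<cdot> t = Idn C P" using projective_lift[OF assms(2) s(4,2) iP] .
  note tg = comp_hom[OF s(2) t(1)]
  let ?d = "diff_arr A A (Idn C A) (t \<cdot> g)"
  have d: "?d \<in> Homs C A A" using diff_hom[OF iA tg] .
  have "g \<cdot> ?d = diff_arr A P g ((g \<cdot> t) \<cdot> g)"
    using comp_diff[OF iA tg s(2)] comp_idn[OF s(2)] comp_assoc[OF s(2) t(1) s(2)] by simp
  then have "g \<cdot> ?d = zero_arr C A P" using t idn_comp[OF s(2)] diff_eq_zero_iff[OF s(2,2)] by simp
  then obtain r where r: "r \<in> Homs C A K" "k \<cdot> r = ?d" using kernel_lift[OF s(3,1,2) d] by blast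
  have "k \<cdot> (r \<cdot> k) = ?d \<cdot> k" using r comp_assoc[OF s(1) r(1) s(1)] by simp
  also have "\<dots> = diff_arr K A k (t \<cdot> (g \<cdot> k))"
    using diff_comp[OF iA tg s(1)] idn_comp[OF s(1)] comp_assoc[OF s(1,2) t(1)] by simp
  also have "\<dots> = k" using s(7) comp_zero[OF t(1) s(8)] diff_zero[OF s(1)] by simp
  also have "\<dots> = k \<cdot> Idn C K" using comp_idn[OF s(1)] by simp
  finally have "r \<cdot> k = Idn C K" using monicD[OF s(5,1) comp_hom[OF s(1) r(1)] iK] by simp
  then show ?thesis using that r by blast
qed

text \<open>
  The sequence splits, so \<open>K\<close> is a retract of \<open>Q\<close>.
\<close>

lemma projective_kernel:
  assumes s: "short_exact C K k Q g P" and P: "projective C P" and Q: "projective C Q"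
  shows "projective C K"
proof -
  note D = short_exactD[OF s]
  obtain r where r: "r \<in> Homs C Q K" "r \<cdot> k = Idn C K" using short_exact_onto_projective_splits[OF s P] .
  show ?thesis unfolding projective_def
  proof (intro conjI allI impI)
    show "K \<in> Obj C" using D by blast
    fix e f assume "epic C e \<and> f \<in> Homs C K (Cod C e)"
    then have e: "epic C e" "e \<in> Homs C (Dom C e) (Cod C e)" and f: "f \<in> Homs C K (Cod C e)"
      by (auto simp: epic_def Homs_def)
    obtain h where h: "h \<in> Homs C Q (Dom C e)" "e \<cdot> h = f \<cdot> r"
      using projective_lift[OF Q e comp_hom[OF r(1) f]] .
    have "e \<cdot> (h \<cdot> k) = f"
      using h r comp_assoc[OF D(1) h(1) e(2)] comp_assoc[OF D(1) r(1) f] comp_idn[OF f] by simp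
    then show "\<exists>g\<in>Homs C K (Dom C e). e \<cdot> g = f" using comp_hom[OF D(1) h(1)] by blast
  qed
qed

lemma ext_vanishes_projective: "projective C P \<Longrightarrow> ext_vanishes C N j P"
proof (induction j arbitrary: P)
  case 0
  show ?case unfolding ext_vanishes.simps
  proof (intro allI impI ballI)
    fix K k A g h assume s: "short_exact C K k A g P" and h: "h \<in> Homs C K N"
    obtain r where r: "r \<in> Homs C A K" "r \<cdot> k = Idn C K" using short_exact_onto_projective_splits[OF s 0] .
    have "(h \<cdot> r) \<cdot> k = h" using comp_assoc[OF short_exactD(1)[OF s] r(1) h] r comp_idn[OF h] by simp
    then show "\<exists>h'\<in>Homs C A N. h' \<cdot> k = h" using comp_hom[OF r(1) h] by blast
  qed
next
  case (Suc j)
  then show ?case unfolding ext_vanishes.simps(2) using projective_kernel by blast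
qed

end

locale abelian_category_with_enough_projectives = abelian_category +
  assumes enough: "enough_projectives C"
begin

lemma obtain_presentation:
  assumes "M \<in> Obj C"
  obtains K k P e where "short_exact C K k P e M" "projective C P"
proof -
  obtain P e where e: "projective C P" "e \<in> Homs C P M" "epic C e"
    using enough assms unfolding enough_projectives_def by blast
  obtain K k where k: "k \<in> Homs C K P" "is_kernel C k e" using obtain_kernel[OF e(2)] .
  have "short_exact C K k P e M" unfolding short_exact_iff using e k by blast
  then show ?thesis using that e by blast
qed

text \<open>
  An arrow on \<open>K\<close> is extended in two steps, along \<open>K \<rightarrow> W\<close> with quotient \<open>X\<close> and \<open>W \<rightarrow> A\<close> with quotient \<open>Z\<close>.
\<close>

lemma ext_vanishes_0_extension:
  assumes s: "short_exact C X x Y z Z" and X: "ext_vanishes C N 0 X" and Z: "ext_vanishes C N 0 Z"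
  shows "ext_vanishes C N 0 Y"
  unfolding ext_vanishes.simps
proof (intro allI impI ballI)
  fix K k A f h assume t: "short_exact C K k A f Y" and h: "h \<in> Homs C K N"
  obtain W l w u where l: "short_exact C K l W u X" and w: "short_exact C W w A (z \<cdot> f) Z" and e: "w \<cdot> l = k"
    and "f \<cdot> w = x \<cdot> u"
    using short_exact_composite[OF t s] .
  obtain a where a: "a \<in> Homs C W N" "a \<cdot> l = h" using ext_vanishes_0_extend[OF X l h] .
  obtain b where b: "b \<in> Homs C A N" "b \<cdot> w = a" using ext_vanishes_0_extend[OF Z w a(1)] .
  have "b \<cdot> k = h" using e a b comp_assoc[OF short_exactD(1)[OF l] short_exactD(1)[OF w] b(1)] by simp
  then show "\<exists>h'\<in>Homs C A N. h' \<cdot> k = h" using b by blast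
qed

text \<open>
  For a projective \<open>P\<close> over \<open>Y\<close>, the kernel \<open>W\<close> of \<open>P \<rightarrow> Z\<close> is a syzygy of \<open>Z\<close>, so it satisfies \<open>Ext\<^sup>1(W, N) = 0\<close>
  and may serve as the cover in the previous criterion for \<open>X\<close>; arrows on the kernel of \<open>W \<rightarrow> X\<close> even
  extend to \<open>P\<close>, by the hypothesis on \<open>Y\<close>.
\<close>

lemma ext_vanishes_0_kernel:
  assumes s: "short_exact C X x Y z Z" and Y: "ext_vanishes C N 0 Y" and Z: "ext_vanishes C N (Suc 0) Z"
  shows "ext_vanishes C N 0 X"
proof -
  obtain L l P g where t: "short_exact C L l P g Y" and P: "projective C P"
    using obtain_presentation[OF short_exactD(9)[OF s]] .
  obtain W l' w u where l: "short_exact C L l' W u X" and w: "short_exact C W w P (z \<cdot> g) Z" and e: "w \<cdot> l' = l"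
    and "g \<cdot> w = x \<cdot> u"
    using short_exact_composite[OF t s] .
  have W: "ext_vanishes C N 0 W" using Z w P unfolding ext_vanishes.simps(2) by blast
  show ?thesis
  proof (rule ext_vanishes_0_if_extension_along_acyclic_cover[OF l W])
    fix h assume h: "h \<in> Homs C L N"
    obtain a where a: "a \<in> Homs C P N" "a \<cdot> l = h" using ext_vanishes_0_extend[OF Y t h] .
    have "(a \<cdot> w) \<cdot> l' = h" using e a comp_assoc[OF short_exactD(1)[OF l] short_exactD(1)[OF w] a(1)] by simp
    then show "\<exists>h'\<in>Homs C W N. h' \<cdot> l' = h" using comp_hom[OF short_exactD(1)[OF w] a(1)] by blast
  qed
qed

text \<open>
  For a syzygy \<open>L\<close> of \<open>Z\<close>, the pullback \<open>B\<close> is an extension of a projective object by \<open>X\<close> and at the same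
  time has quotient \<open>Y\<close> with kernel \<open>L\<close>.
\<close>

lemma ext_vanishes_quotient_step:
  assumes ext: "\<And>X x Y z Z. short_exact C X x Y z Z \<Longrightarrow> ext_vanishes C N j X \<Longrightarrow> ext_vanishes C N j Z \<Longrightarrow> ext_vanishes C N j Y"
    and ker: "\<And>X x Y z Z. short_exact C X x Y z Z \<Longrightarrow> ext_vanishes C N j Y \<Longrightarrow> ext_vanishes C N (Suc j) Z \<Longrightarrow> ext_vanishes C N j X"
    and s: "short_exact C X x Y z Z" and X: "ext_vanishes C N j X" and Y: "ext_vanishes C N (Suc j) Y"
  shows "ext_vanishes C N (Suc j) Z"
  unfolding ext_vanishes.simps(2)
proof (intro allI impI)
  fix L l P g assume "short_exact C L l P g Z \<and> projective C P"
  then have t: "short_exact C L l P g Z" and P: "projective C P" by auto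
  obtain B b p i q where b: "short_exact C X b B q P" and i: "short_exact C L i B p Y"
    and "p \<cdot> b = x" "q \<cdot> i = l" "z \<cdot> p = g \<cdot> q"
    using short_exact_pullback[OF s t] .
  show "ext_vanishes C N j L" using ker[OF i ext[OF b X ext_vanishes_projective[OF P]] Y] .
qed

text \<open>
  A projective object over \<open>Y\<close> also presents \<open>Z\<close>, and the two syzygies \<open>L\<close> of \<open>Y\<close> and \<open>W\<close> of \<open>Z\<close> form the rotated
  sequence \<open>0 \<rightarrow> L \<rightarrow> W \<rightarrow> X \<rightarrow> 0\<close>. In it, the extension property in degree \<open>j + 1\<close> is the kernel property in
  degree \<open>j\<close>, and the kernel property in degree \<open>j + 1\<close> is the quotient property from degree \<open>j\<close>.
\<close>

lemma ext_vanishes_extension_and_kernel: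
  "(\<forall>X x Y z Z. short_exact C X x Y z Z \<longrightarrow> ext_vanishes C N j X \<longrightarrow> ext_vanishes C N j Z \<longrightarrow> ext_vanishes C N j Y) \<and>
   (\<forall>X x Y z Z. short_exact C X x Y z Z \<longrightarrow> ext_vanishes C N j Y \<longrightarrow> ext_vanishes C N (Suc j) Z \<longrightarrow> ext_vanishes C N j X)"
proof (induction j)
  case 0
  show ?case using ext_vanishes_0_extension ext_vanishes_0_kernel by blast
next
  case (Suc j)
  then have ext: "\<And>X x Y z Z. short_exact C X x Y z Z \<Longrightarrow> ext_vanishes C N j X \<Longrightarrow> ext_vanishes C N j Z \<Longrightarrow> ext_vanishes C N j Y"
    and ker: "\<And>X x Y z Z. short_exact C X x Y z Z \<Longrightarrow> ext_vanishes C N j Y \<Longrightarrow> ext_vanishes C N (Suc j) Z \<Longrightarrow> ext_vanishes C N j X"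
    by blast+
  show ?case
  proof (intro conjI allI impI)
    fix X x Y z Z
    assume s: "short_exact C X x Y z Z" and X: "ext_vanishes C N (Suc j) X" and Z: "ext_vanishes C N (Suc j) Z"
    show "ext_vanishes C N (Suc j) Y" unfolding ext_vanishes.simps(2)
    proof (intro allI impI)
      fix L l P g assume "short_exact C L l P g Y \<and> projective C P"
      then have t: "short_exact C L l P g Y" and P: "projective C P" by auto
      obtain W l' w u where l: "short_exact C L l' W u X" and w: "short_exact C W w P (z \<cdot> g) Z"
        and "w \<cdot> l' = l" "g \<cdot> w = x \<cdot> u"
        using short_exact_composite[OF t s] .
      have "ext_vanishes C N j W" using Z w P unfolding ext_vanishes.simps(2) by blast
      then show "ext_vanishes C N j L" using ker[OF l _ X] by blast
    qed
  next
    fix X x Y z Z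
    assume s: "short_exact C X x Y z Z" and Y: "ext_vanishes C N (Suc j) Y" and Z: "ext_vanishes C N (Suc (Suc j)) Z"
    obtain L l P g where t: "short_exact C L l P g Y" and P: "projective C P"
      using obtain_presentation[OF short_exactD(9)[OF s]] .
    obtain W l' w u where l: "short_exact C L l' W u X" and w: "short_exact C W w P (z \<cdot> g) Z"
      and "w \<cdot> l' = l" "g \<cdot> w = x \<cdot> u"
      using short_exact_composite[OF t s] .
    have L: "ext_vanishes C N j L" using Y t P unfolding ext_vanishes.simps(2) by blast
    have W: "ext_vanishes C N (Suc j) W"
      using Z w P unfolding ext_vanishes.simps(2)[of C N "Suc j"] by blast
    show "ext_vanishes C N (Suc j) X" by (rule ext_vanishes_quotient_step[OF ext ker l L W])
  qed
qed

lemma ext_vanishes_kernel: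
  "short_exact C X x Y z Z \<Longrightarrow> ext_vanishes C N j Y \<Longrightarrow> ext_vanishes C N (Suc j) Z \<Longrightarrow> ext_vanishes C N j X"
  using conjunct2[OF ext_vanishes_extension_and_kernel, rule_format] .

lemma ext_vanishes_quotient:
  "short_exact C X x Y z Z \<Longrightarrow> ext_vanishes C N j X \<Longrightarrow> ext_vanishes C N (Suc j) Y \<Longrightarrow> ext_vanishes C N (Suc j) Z"
  by (rule ext_vanishes_quotient_step[OF conjunct1[OF ext_vanishes_extension_and_kernel, rule_format]
    conjunct2[OF ext_vanishes_extension_and_kernel, rule_format]])

text \<open>
  By the quotient property, one projective presentation decides.
\<close>

lemma ext_vanishes_Suc_iff:
  "short_exact C K k P e M \<Longrightarrow> projective C P \<Longrightarrow> ext_vanishes C N (Suc j) M \<longleftrightarrow> ext_vanishes C N j K"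
  using ext_vanishes_quotient[OF _ _ ext_vanishes_projective] unfolding ext_vanishes.simps(2) by metis

end

section \<open>Syzygies of long exact sequences\<close>

context abelian_category
begin

lemma obtain_syzygy:
  assumes a: "a \<in> Homs C A M" "exact_at C a (to_null C M)" and b: "b \<in> Homs C B A" "exact_at C b a"
  obtains K k e where "short_exact C K k A a M" "e \<in> Homs C B K" "epic C e" "k \<cdot> e = b"
proof -
  obtain K k e where k: "k \<in> Homs C K A" "is_kernel C k a" "e \<in> Homs C B K" "epic C e" "k \<cdot> e = b"
    using b unfolding exact_at_iff[OF b(1) a(1)] by blast
  have "epic C a" using a exact_to_zero_iff[OF a(1) null_obj to_null_hom] hom_arr(5)[OF a(1)] by blast
  then have "short_exact C K k A a M" unfolding short_exact_iff using k a by blast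
  then show ?thesis using that k by blast
qed

lemma is_kernel_monic_comp_iff:
  assumes k: "monic C k" "k \<in> Homs C K A" and e: "e \<in> Homs C B K"
  shows "is_kernel C i (k \<cdot> e) \<longleftrightarrow> is_kernel C i e"
proof -
  note ke = comp_hom[OF e k(2)]
  have zero: "(k \<cdot> e) \<cdot> h = zero_arr C t A \<longleftrightarrow> e \<cdot> h = zero_arr C t K" if h: "h \<in> Homs C t B" for t h
    using comp_assoc[OF h e k(2)] monic_zero[OF k comp_hom[OF h e]] comp_zero[OF k(2) hom_arr(4)[OF h]] by metis
  have "i \<in> Homs C (Dom C i) B" if "i \<in> Arr C" "Cod C i = B" using that by (simp add: Homs_def)
  then show ?thesis
    unfolding is_kernel_def hom_arr(2,3)[OF ke] hom_arr(2,3)[OF e]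
    using hom_arr(1)[OF ke] hom_arr(1)[OF e] by (simp add: zero cong: conj_cong ball_cong)
qed

lemma exact_at_monic_comp_iff:
  assumes k: "monic C k" "k \<in> Homs C K A" and e: "e \<in> Homs C B K"
  shows "exact_at C f (k \<cdot> e) \<longleftrightarrow> exact_at C f e"
  unfolding exact_at_def is_kernel_monic_comp_iff[OF assms] ..

text \<open>
  Chopping off the first term leaves a sequence of the same shape that resolves the syzygy; the
  inductions on resolutions below all peel them in this way.
\<close>

lemma long_exact_syzygy:
  assumes L: "long_exact C X d M"
  obtains K k e where "short_exact C K k (X 0) (d 0) M" "e \<in> Homs C (X (Suc 0)) K" "epic C e"
    "k \<cdot> e = d (Suc 0)" "long_exact C (\<lambda>i. X (Suc i)) (case_nat e (\<lambda>i. d (Suc (Suc i)))) K"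
proof -
  have d: "d 0 \<in> Homs C (X 0) M" "\<And>i. d (Suc i) \<in> Homs C (X (Suc i)) (X i)"
    and ex: "exact_at C (d 0) (to_null C M)" "\<And>i. exact_at C (d (Suc i)) (d i)"
    using L unfolding long_exact_def by auto
  obtain K k e where s: "short_exact C K k (X 0) (d 0) M" and e: "e \<in> Homs C (X (Suc 0)) K" "epic C e" "k \<cdot> e = d (Suc 0)"
    using obtain_syzygy[OF d(1) ex(1) d(2) ex(2)] .
  note sD = short_exactD[OF s]
  have "exact_at C e (to_null C K)" using exact_to_zero_iff[OF e(1) null_obj to_null_hom[OF sD(8)]] e by blast
  moreover have "exact_at C (d (Suc (Suc 0))) e"
    using exact_at_monic_comp_iff[OF sD(5,1) e(1)] e(3) ex(2) by metis
  ultimately have "long_exact C (\<lambda>i. X (Suc i)) (case_nat e (\<lambda>i. d (Suc (Suc i)))) K"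
    unfolding long_exact_def using d ex e by (auto split: nat.split)
  then show ?thesis using that s e by blast
qed

lemma finite_exact_syzygy:
  assumes L: "finite_exact C (Suc n) X d M"
  obtains K k e where "short_exact C K k (X 0) (d 0) M"
    "finite_exact C n (\<lambda>i. X (Suc i)) (case_nat e (\<lambda>i. d (Suc (Suc i)))) K"
proof -
  have d: "d 0 \<in> Homs C (X 0) M" "\<And>i. i \<le> n \<Longrightarrow> d (Suc i) \<in> Homs C (X (Suc i)) (X i)"
    and ex: "exact_at C (d 0) (to_null C M)" "\<And>i. i \<le> n \<Longrightarrow> exact_at C (d (Suc i)) (d i)"
    and mono: "exact_at C (from_null C (X (Suc n))) (d (Suc n))"
    using L unfolding finite_exact_def by auto
  obtain K k e where s: "short_exact C K k (X 0) (d 0) M" and e: "e \<in> Homs C (X (Suc 0)) K" "epic C e" "k \<cdot> e = d (Suc 0)"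
    using obtain_syzygy[OF d(1) ex(1) d(2) ex(2)] by auto
  note sD = short_exactD[OF s]
  have "exact_at C e (to_null C K)" using exact_to_zero_iff[OF e(1) null_obj to_null_hom[OF sD(8)]] e by blast
  moreover have "exact_at C f (d (Suc 0)) \<longleftrightarrow> exact_at C f e" for f
    using exact_at_monic_comp_iff[OF sD(5,1) e(1)] e(3) by simp
  then have "exact_at C (d (Suc (Suc 0))) e" if "0 < n" using ex(2)[of "Suc 0"] that by simp
  moreover have "exact_at C (from_null C (X (Suc 0))) e" if "n = 0"
    using mono that \<open>\<And>f. exact_at C f (d (Suc 0)) \<longleftrightarrow> exact_at C f e\<close> by simp
  ultimately have "finite_exact C n (\<lambda>i. X (Suc i)) (case_nat e (\<lambda>i. d (Suc (Suc i)))) K"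
    unfolding finite_exact_def using d ex e mono by (auto split: nat.split)
  then show ?thesis using that s by blast
qed

lemma member_in_dim_class:
  assumes M: "M \<in> F" "M \<in> Obj C"
  shows "M \<in> dim_class C F \<alpha>"
proof -
  \<comment> \<open>The resolution \<open>\<dots> \<rightarrow> 0 \<rightarrow> 0 \<rightarrow> M \<rightarrow> M \<rightarrow> 0\<close>, whose arrows are all monic.\<close>
  define X where "X = case_nat M (\<lambda>_. null_obj C)"
  define d where "d = case_nat (Idn C M) (\<lambda>i. zero_arr C (null_obj C) (X i))"
  have X: "X i \<in> Obj C" for i using M null_in_Obj[OF null_obj] by (auto simp: X_def split: nat.split)
  have d0: "d 0 \<in> Homs C (X 0) M" using idn_hom[OF M(2)] by (simp add: d_def X_def)
  have dS: "d (Suc i) \<in> Homs C (null_obj C) (X i)" for i using from_null_hom[OF X] by (simp add: d_def)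
  have "\<exists>B. d i \<in> Homs C (X i) B \<and> monic C (d i)" for i
  proof (cases i)
    case 0 then show ?thesis using d0 idn_monic[OF M(2)] by (auto simp: d_def)
  next
    case (Suc j) then show ?thesis using dS[of j] zero_monic[OF null_obj dS[of j]] by (auto simp: X_def)
  qed
  then have "exact_at C (d (Suc i)) (d i)" for i
    using exact_from_zero_iff[OF _ null_obj dS] by blast
  moreover have "exact_at C (d 0) (to_null C M)"
    using exact_to_zero_iff[OF d0 null_obj to_null_hom[OF M(2)]] idn_epic[OF M(2)] by (simp add: d_def)
  ultimately have "long_exact C X d M" unfolding long_exact_def using d0 dS by (auto simp: X_def)
  moreover have "\<forall>i. X i \<in> F \<or> zero_object C (X i)" using M null_obj by (auto simp: X_def split: nat.split)
  moreover have "\<forall>i. enat i > \<alpha> \<longrightarrow> zero_object C (X i)"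
  proof (intro allI impI)
    fix i assume "enat i > \<alpha>"
    then have "enat i \<noteq> 0" by auto
    then obtain j where "i = Suc j" by (cases i) (auto simp: zero_enat_def)
    then show "zero_object C (X i)" using null_obj by (simp add: X_def)
  qed
  ultimately show ?thesis
    unfolding dim_class_def using M(2) by (intro CollectI conjI exI[of _ X] exI[of _ d])
qed

lemma short_exact_finite_exact:
  assumes s: "short_exact C K k A g M"
  shows "finite_exact C 1 (case_nat A (\<lambda>_. K)) (case_nat g (\<lambda>_. k)) M"
  using s unfolding short_exact_def finite_exact_def by simp

end

section \<open>Comparison with the Ext groups\<close>

lemma trivial_quotient_iff:
  assumes H: "comm_group H" and S: "subgroup S H" and B: "subgroup B H" "B \<subseteq> S"
  shows "trivial_group (H\<lparr>carrier := S\<rparr> Mod B) \<longleftrightarrow> S \<subseteq> B"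
proof -
  interpret H: comm_group H by fact
  interpret S: comm_group "H\<lparr>carrier := S\<rparr>"
    by (rule group.group_comm_groupI[OF subgroup.subgroup_is_group[OF S H.is_group]])
      (use subgroup.mem_carrier[OF S] H.m_comm in auto)
  have sub: "subgroup B (H\<lparr>carrier := S\<rparr>)" using H.subgroup_incl[OF B(1) S B(2)] .
  have n: "normal B (H\<lparr>carrier := S\<rparr>)" using S.normal_iff_subgroup sub by blast
  interpret Q: group "H\<lparr>carrier := S\<rparr> Mod B" using normal.factorgroup_is_group[OF n] .
  have "trivial_group (H\<lparr>carrier := S\<rparr> Mod B) \<longleftrightarrow> (\<forall>a \<in> S. B #>\<^bsub>H\<lparr>carrier := S\<rparr>\<^esub> a = B)"
    unfolding Q.trivial_group_subset by (auto simp: FactGroup_def RCOSETS_def)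
  also have "\<dots> \<longleftrightarrow> (\<forall>a \<in> S. a \<in> B)"
    using S.coset_join1[OF _ _ sub] S.coset_join2[OF _ sub] subgroup.subset[OF sub] by auto
  finally show ?thesis by blast
qed

lemma (in abelian_category) trivial_Hom_cohomology_iff:
  assumes L: "long_exact C P d M" and N: "N \<in> Obj C"
  shows "trivial_group (Hom_cohomology C P d N (Suc j)) \<longleftrightarrow>
    (\<forall>f \<in> Homs C (P (Suc j)) N. f \<cdot> d (Suc (Suc j)) = zero_arr C (P (Suc (Suc j))) N \<longrightarrow>
      (\<exists>g \<in> Homs C (P j) N. g \<cdot> d (Suc j) = f))"
proof -
  have d: "\<And>i. d (Suc i) \<in> Homs C (P (Suc i)) (P i)" and ex: "\<And>i. exact_at C (d (Suc i)) (d i)"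
    using L unfolding long_exact_def by auto
  have P: "P i \<in> Obj C" for i using hom_arr(5)[OF d] .
  have gh: "group_hom (Hgrp C (P i) N) (Hgrp C (P (Suc i)) N) (coboundary C d i)" for i
    using precomp_additive[OF d N] hgrp_group P N unfolding coboundary_def
    by (simp add: group_hom_def group_hom_axioms_def)
  let ?H = "Hgrp C (P (Suc j)) N"
  have S: "subgroup (cocycles C P d N (Suc j)) ?H"
    unfolding cocycles_def using group_hom.subgroup_kernel[OF gh] .
  have B: "subgroup (coboundaries C P d N (Suc j)) ?H"
    unfolding coboundaries_def using group_hom.img_is_subgroup[OF gh] by simp
  have cyc: "cocycles C P d N (Suc j) =
      {f \<in> Homs C (P (Suc j)) N. f \<cdot> d (Suc (Suc j)) = zero_arr C (P (Suc (Suc j))) N}"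
    unfolding cocycles_def kernel_def hgrp_carrier[OF P N] coboundary_def ..
  have bnd: "coboundaries C P d N (Suc j) = (\<lambda>g. g \<cdot> d (Suc j)) ` Homs C (P j) N"
    unfolding coboundaries_def using hgrp_carrier[OF P N] by (simp add: coboundary_def)
  have "coboundaries C P d N (Suc j) \<subseteq> cocycles C P d N (Suc j)"
  proof
    fix f assume "f \<in> coboundaries C P d N (Suc j)"
    then obtain g where g: "g \<in> Homs C (P j) N" "f = g \<cdot> d (Suc j)" unfolding bnd by blast
    have "f \<cdot> d (Suc (Suc j)) = g \<cdot> (d (Suc j) \<cdot> d (Suc (Suc j)))"
      using g comp_assoc[OF d d g(1)] by simp
    also have "\<dots> = zero_arr C (P (Suc (Suc j))) N"
      using exact_at_comp_zero[OF ex d d] comp_zero[OF g(1) P] by simp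
    finally show "f \<in> cocycles C P d N (Suc j)" unfolding cyc using g comp_hom[OF d g(1)] by blast
  qed
  from trivial_quotient_iff[OF hgrp_comm_group[OF P N] S B this]
  have "trivial_group (Hom_cohomology C P d N (Suc j)) \<longleftrightarrow>
      cocycles C P d N (Suc j) \<subseteq> coboundaries C P d N (Suc j)"
    unfolding Hom_cohomology_def .
  then show ?thesis unfolding cyc bnd by (auto simp: subset_iff image_iff)
qed

context abelian_category_with_enough_projectives
begin

text \<open>
  Chopping the resolution shifts both sides to the syzygy, so only \<open>Ext\<^sup>1\<close> has to be compared. There a
  cocycle \<open>P 1 \<rightarrow> N\<close> is the same as an arrow \<open>K \<rightarrow> N\<close> on the syzygy \<open>K \<subseteq> P 0\<close>, and it is a coboundary
  exactly if that arrow extends to \<open>P 0\<close>.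
\<close>

lemma trivial_Hom_cohomology_iff_ext_vanishes:
  assumes N: "N \<in> Obj C"
  shows "proj_resolution C M P d \<Longrightarrow>
    trivial_group (Hom_cohomology C P d N (Suc j)) \<longleftrightarrow> ext_vanishes C N j M"
proof (induction j arbitrary: M P d)
  case 0
  then have L: "long_exact C P d M" and P: "projective C (P i)" for i unfolding proj_resolution_def by auto
  have d: "d (Suc i) \<in> Homs C (P (Suc i)) (P i)" for i using L unfolding long_exact_def by auto
  obtain K k e where s: "short_exact C K k (P 0) (d 0) M" and e: "e \<in> Homs C (P (Suc 0)) K" "epic C e"
    and ke: "k \<cdot> e = d (Suc 0)"
    and L': "long_exact C (\<lambda>i. P (Suc i)) (case_nat e (\<lambda>i. d (Suc (Suc i)))) K"
    using long_exact_syzygy[OF L] .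
  note sD = short_exactD[OF s]
  have "\<forall>i. exact_at C (case_nat e (\<lambda>i. d (Suc (Suc i))) (Suc i)) (case_nat e (\<lambda>i. d (Suc (Suc i))) i)"
    using L' unfolding long_exact_def by blast
  from spec[OF this, of 0] have L'0: "exact_at C e (to_null C K)" "exact_at C (d (Suc (Suc 0))) e"
    using L' unfolding long_exact_def by simp_all
  obtain I i e' where i: "short_exact C I i (P (Suc 0)) e K" and e': "e' \<in> Homs C (P (Suc (Suc 0))) I" "epic C e'"
    and ie: "i \<cdot> e' = d (Suc (Suc 0))"
    using obtain_syzygy[OF e(1) L'0(1) d L'0(2)] .
  note iD = short_exactD[OF i]
  have "ext_vanishes C N 0 M \<longleftrightarrow> (\<forall>h \<in> Homs C K N. \<exists>g \<in> Homs C (P 0) N. g \<cdot> k = h)"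
    using ext_vanishes_0_if_extension_along_acyclic_cover[OF s ext_vanishes_projective[OF P]]
      ext_vanishes_0_extend[OF _ s] by metis
  also have "\<dots> \<longleftrightarrow> (\<forall>f \<in> Homs C (P (Suc 0)) N. f \<cdot> d (Suc (Suc 0)) = zero_arr C (P (Suc (Suc 0))) N \<longrightarrow>
      (\<exists>g \<in> Homs C (P 0) N. g \<cdot> d (Suc 0) = f))"
  proof (intro iffI ballI impI)
    fix f assume R: "\<forall>h \<in> Homs C K N. \<exists>g \<in> Homs C (P 0) N. g \<cdot> k = h"
      and f: "f \<in> Homs C (P (Suc 0)) N" "f \<cdot> d (Suc (Suc 0)) = zero_arr C (P (Suc (Suc 0))) N"
    have "(f \<cdot> i) \<cdot> e' = zero_arr C (P (Suc (Suc 0))) N" using f ie comp_assoc[OF e'(1) iD(1) f(1)] by simp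
    then have "f \<cdot> i = zero_arr C I N" using epic_zero[OF e'(2,1) comp_hom[OF iD(1) f(1)]] by simp
    then obtain h where h: "h \<in> Homs C K N" "h \<cdot> e = f" using cokernel_desc[OF iD(6,1,2) f(1)] by blast
    then obtain g where g: "g \<in> Homs C (P 0) N" "g \<cdot> k = h" using R by blast
    then show "\<exists>g \<in> Homs C (P 0) N. g \<cdot> d (Suc 0) = f" using h ke comp_assoc[OF e(1) sD(1) g(1)] by metis
  next
    fix h assume R: "\<forall>f \<in> Homs C (P (Suc 0)) N. f \<cdot> d (Suc (Suc 0)) = zero_arr C (P (Suc (Suc 0))) N \<longrightarrow>
        (\<exists>g \<in> Homs C (P 0) N. g \<cdot> d (Suc 0) = f)" and h: "h \<in> Homs C K N"
    have "(h \<cdot> e) \<cdot> d (Suc (Suc 0)) = (h \<cdot> (e \<cdot> i)) \<cdot> e'"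
      using ie comp_assoc[OF e'(1) iD(1) comp_hom[OF e(1) h]] comp_assoc[OF iD(1,2) h] by simp
    also have "\<dots> = zero_arr C (P (Suc (Suc 0))) N"
      using iD(7) comp_zero[OF h iD(8)] zero_comp[OF e'(1) N] by simp
    finally obtain g where g: "g \<in> Homs C (P 0) N" "g \<cdot> d (Suc 0) = h \<cdot> e" using R comp_hom[OF e(1) h] by blast
    have "(g \<cdot> k) \<cdot> e = h \<cdot> e" using g ke comp_assoc[OF e(1) sD(1) g(1)] by simp
    then have "g \<cdot> k = h" using epicD[OF e(2,1) comp_hom[OF sD(1) g(1)] h] by blast
    then show "\<exists>g \<in> Homs C (P 0) N. g \<cdot> k = h" using g by blast
  qed
  finally show ?case unfolding trivial_Hom_cohomology_iff[OF L N] by blast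
next
  case (Suc j)
  then have L: "long_exact C P d M" and P: "projective C (P i)" for i unfolding proj_resolution_def by auto
  obtain K k e where s: "short_exact C K k (P 0) (d 0) M" and "e \<in> Homs C (P (Suc 0)) K" "epic C e"
    and "k \<cdot> e = d (Suc 0)"
    and L': "long_exact C (\<lambda>i. P (Suc i)) (case_nat e (\<lambda>i. d (Suc (Suc i)))) K"
    using long_exact_syzygy[OF L] .
  have "proj_resolution C K (\<lambda>i. P (Suc i)) (case_nat e (\<lambda>i. d (Suc (Suc i))))"
    unfolding proj_resolution_def using L' P by blast
  note IH = Suc.IH[OF this]
  have "trivial_group (Hom_cohomology C P d N (Suc (Suc j))) \<longleftrightarrow>
      trivial_group (Hom_cohomology C (\<lambda>i. P (Suc i)) (case_nat e (\<lambda>i. d (Suc (Suc i)))) N (Suc j))"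
    unfolding trivial_Hom_cohomology_iff[OF L N] trivial_Hom_cohomology_iff[OF L' N] nat.case ..
  then show ?case unfolding IH ext_vanishes_Suc_iff[OF s P] .
qed

text \<open>
  Iterate a chosen presentation \<open>0 \<rightarrow> K M \<rightarrow> P M \<rightarrow> M \<rightarrow> 0\<close> and splice; \<open>Z i\<close> is the \<open>i\<close>-th syzygy.
\<close>

lemma ex_proj_resolution:
  assumes M: "M \<in> Obj C"
  shows "\<exists>P d. proj_resolution C M P d"
proof -
  have "\<forall>M. \<exists>K k P e. M \<in> Obj C \<longrightarrow> short_exact C K k P e M \<and> projective C P"
    using obtain_presentation by metis
  then obtain K k P e where F: "\<forall>M. M \<in> Obj C \<longrightarrow> short_exact C (K M) (k M) (P M) (e M) M \<and> projective C (P M)"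
    by metis
  define Z where "Z i = (K ^^ i) M" for i
  have Z0: "Z 0 = M" and ZS: "Z (Suc i) = K (Z i)" for i unfolding Z_def by simp_all
  have Z: "Z i \<in> Obj C" for i
    by (induction i) (use M F short_exactD(8) in \<open>auto simp: Z0 ZS\<close>)
  have s: "short_exact C (Z (Suc i)) (k (Z i)) (P (Z i)) (e (Z i)) (Z i)" and pr: "projective C (P (Z i))" for i
    using F Z by (auto simp: ZS)
  note sD = short_exactD[OF s]
  define d where "d = case_nat (e M) (\<lambda>i. k (Z i) \<cdot> e (Z (Suc i)))"
  have dS: "d (Suc i) \<in> Homs C (P (Z (Suc i))) (P (Z i))" for i
    unfolding d_def using comp_hom[OF sD(2) sD(1)] by simp
  have d0: "d 0 \<in> Homs C (P (Z 0)) M" using sD(2)[of 0] by (simp add: d_def Z0)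
  have ker: "is_kernel C (k (Z i)) (d i)" for i
  proof (cases i)
    case 0 then show ?thesis using sD(3)[of 0] by (simp add: d_def Z0)
  next
    case (Suc j) then show ?thesis
      using is_kernel_monic_comp_iff[OF sD(5) sD(1) sD(2)] sD(3) by (simp add: d_def)
  qed
  have "exact_at C (d (Suc i)) (d i)" for i
  proof -
    have di: "\<exists>B. d i \<in> Homs C (P (Z i)) B" using d0 dS by (cases i) blast+
    then obtain B where "d i \<in> Homs C (P (Z i)) B" by blast
    moreover have "k (Z i) \<cdot> e (Z (Suc i)) = d (Suc i)" by (simp add: d_def)
    ultimately show ?thesis using exact_at_iff[OF dS] ker sD(1) sD(2) sD(4) by blast
  qed
  moreover have "exact_at C (d 0) (to_null C M)"
    using exact_to_zero_iff[OF d0 null_obj to_null_hom[OF M]] sD(4)[of 0] by (simp add: d_def Z0)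
  ultimately have "proj_resolution C M (\<lambda>i. P (Z i)) d"
    unfolding proj_resolution_def long_exact_def using d0 dS pr by blast
  then show ?thesis by blast
qed

lemma trivial_Ext_iff:
  assumes M: "M \<in> Obj C" and N: "N \<in> Obj C"
  shows "trivial_group (Ext C (Suc j) M N) \<longleftrightarrow> ext_vanishes C N j M"
proof -
  define Pd where "Pd = (SOME (P, d). proj_resolution C M P d)"
  have "case Pd of (P, d) \<Rightarrow> proj_resolution C M P d"
    unfolding Pd_def by (rule someI_ex) (use ex_proj_resolution[OF M] in auto)
  then show ?thesis
    using trivial_Hom_cohomology_iff_ext_vanishes[OF N] unfolding Ext_def Pd_def[symmetric] by (auto split: prod.split)
qed

lemma perp_eq:
  assumes G: "G \<subseteq> Obj C"
  shows "perp C m G = {M \<in> Obj C. \<forall>j<m. \<forall>N\<in>G. ext_vanishes C N j M}"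
proof -
  have "(\<forall>i N. 1 \<le> i \<and> i \<le> m \<and> N \<in> G \<longrightarrow> trivial_group (Ext C i M N)) \<longleftrightarrow>
      (\<forall>j<m. \<forall>N\<in>G. ext_vanishes C N j M)" (is "?l \<longleftrightarrow> ?r") if M: "M \<in> Obj C" for M
  proof
    assume ?l then show ?r using trivial_Ext_iff[OF M] G by (metis Suc_leI le_add1 plus_1_eq_Suc subsetD)
  next
    assume r: ?r show ?l
    proof (intro allI impI)
      fix i N assume i: "1 \<le> i \<and> i \<le> m \<and> N \<in> G"
      then obtain j where "i = Suc j" by (cases i) auto
      then show "trivial_group (Ext C i M N)" using i r trivial_Ext_iff[OF M] G by auto
    qed
  qed
  then show ?thesis unfolding perp_def by blast
qed

lemma perp_inf_eq:
  assumes G: "G \<subseteq> Obj C"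
  shows "perp_inf C G = {M \<in> Obj C. \<forall>j. \<forall>N\<in>G. ext_vanishes C N j M}"
  unfolding perp_inf_def perp_eq[OF G] by (auto intro: lessI)

end

section \<open>Dimension shifting\<close>

context abelian_category_with_enough_projectives
begin

text \<open>
  The quotient property is applied up the resolution from its last nonzero term. At the end of the
  resolution the syzygy is zero and \<open>Ext\<^sup>1\<close> has no predecessor in the induction, so there the extension
  criterion is used directly.
\<close>

lemma ext_vanishes_above_dimension:
  assumes "long_exact C X d M" "\<And>i j. ext_vanishes C N j (X i)" "\<And>i. n < i \<Longrightarrow> zero_object C (X i)"
    "N \<in> Obj C" "n \<le> j"
  shows "ext_vanishes C N j M"
  using assms(1,2,3,5)
proof (induction n arbitrary: X d M j)
  case 0
  obtain K k e where s: "short_exact C K k (X 0) (d 0) M" and e: "e \<in> Homs C (X (Suc 0)) K" "epic C e"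
    and "k \<cdot> e = d (Suc 0)"
    and "long_exact C (\<lambda>i. X (Suc i)) (case_nat e (\<lambda>i. d (Suc (Suc i)))) K"
    using long_exact_syzygy[OF 0(1)] .
  have K: "zero_object C K" using epic_from_zero_object[OF 0(3) e] by blast
  show ?case
  proof (cases j)
    case 0
    have "ext_vanishes C N 0 M"
    proof (rule ext_vanishes_0_if_extension_along_acyclic_cover[OF s \<open>\<And>i j. ext_vanishes C N j (X i)\<close>])
      fix h assume h: "h \<in> Homs C K N"
      have "zero_arr C (X 0) N \<cdot> k = h"
        using zero_comp[OF short_exactD(1)[OF s] assms(4)] from_zero_object[OF K h] by simp
      then show "\<exists>h' \<in> Homs C (X 0) N. h' \<cdot> k = h" using zero_hom[OF short_exactD(9)[OF s] assms(4)] by blast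
    qed
    then show ?thesis using 0 by simp
  next
    case (Suc i)
    then show ?thesis
      using ext_vanishes_quotient[OF s ext_vanishes_projective[OF zero_object_projective[OF K]] 0(2)] by simp
  qed
next
  case (Suc n)
  obtain K k e where s: "short_exact C K k (X 0) (d 0) M" and "e \<in> Homs C (X (Suc 0)) K" "epic C e"
    and "k \<cdot> e = d (Suc 0)"
    and L: "long_exact C (\<lambda>i. X (Suc i)) (case_nat e (\<lambda>i. d (Suc (Suc i)))) K"
    using long_exact_syzygy[OF Suc.prems(1)] .
  obtain i where i: "j = Suc i" "n \<le> i" using Suc.prems(4) by (cases j) auto
  have "ext_vanishes C N i K" by (rule Suc.IH[OF L _ _ i(2)]) (use Suc.prems in auto)
  then show ?case using ext_vanishes_quotient[OF s _ Suc.prems(2)] i by simp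
qed

text \<open>
  The kernel property moves the vanishing range down by one with each term. For \<open>n = 0\<close> the object
  \<open>X 0\<close> is isomorphic to \<open>M\<close>; the kernel property for \<open>0 \<rightarrow> X 0 \<rightarrow> M \<rightarrow> 0 \<rightarrow> 0\<close> covers this case.
\<close>

lemma ext_vanishes_last_syzygy:
  assumes "finite_exact C n X d M" "\<And>i j. i < n \<Longrightarrow> ext_vanishes C N j (X i)"
    "\<And>j. n \<le> j \<Longrightarrow> ext_vanishes C N j M"
  shows "ext_vanishes C N j (X n)"
  using assms
proof (induction n arbitrary: X d M)
  case 0
  then have d: "d 0 \<in> Homs C (X 0) M" and ex: "exact_at C (d 0) (to_null C M)" "exact_at C (from_null C (X 0)) (d 0)"
    unfolding finite_exact_def by auto
  have M: "M \<in> Obj C" using hom_arr d by blast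
  have "exact_at C (to_null C M) (to_null C (null_obj C))"
    using exact_to_zero_iff[OF to_null_hom[OF M] null_obj to_null_hom[OF null_in_Obj[OF null_obj]]]
      zero_epic[OF null_obj to_null_hom[OF M]] by blast
  then have "short_exact C (X 0) (d 0) M (to_null C M) (null_obj C)"
    unfolding short_exact_def using d ex to_null_hom[OF M] by blast
  then show ?case
    using ext_vanishes_kernel[OF _ 0(3) ext_vanishes_projective[OF zero_object_projective[OF null_obj]]] by blast
next
  case (Suc n)
  obtain K k e where s: "short_exact C K k (X 0) (d 0) M"
    and L: "finite_exact C n (\<lambda>i. X (Suc i)) (case_nat e (\<lambda>i. d (Suc (Suc i)))) K"
    using finite_exact_syzygy[OF Suc.prems(1)] .
  show ?case
  proof (rule Suc.IH[OF L])
    show "ext_vanishes C N j (X (Suc i))" if "i < n" for i j using Suc.prems(2) that by blast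
    show "ext_vanishes C N j K" if "n \<le> j" for j
      by (rule ext_vanishes_kernel[OF s Suc.prems(2) Suc.prems(3)]) (use that in simp_all)
  qed
qed

end

section \<open>Perpendicular classes that define a homological dimension\<close>

theorem proposition1p13:
  fixes C :: "('o, 'm, 'x) precategory_scheme" and F G :: "'o set" and m :: nat
  assumes "abelian_category C"
    and "enough_projectives C"
    and "G \<subseteq> Obj C"
    and "1 \<le> m"
    and "F = perp C m G"
  shows "(defines_homological_dimension C F \<longleftrightarrow> F = perp_inf C G) \<and>
    (defines_homological_dimension C F \<longrightarrow> Obj C = quotient_class C F)"
proof -
  interpret abelian_category_with_enough_projectives C
    using assms(1,2) unfolding abelian_category_with_enough_projectives_def
      abelian_category_with_enough_projectives_axioms_def by blast
  note F = assms(5)[unfolded perp_eq[OF assms(3)]]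
  note inf = perp_inf_eq[OF assms(3)]
  have FO: "F \<subseteq> Obj C" unfolding F by blast
  have proj: "P \<in> F" if "projective C P" for P
    unfolding F using ext_vanishes_projective[OF that] that by (auto simp: projective_def)
  have "Obj C = quotient_class C F"
    unfolding quotient_class_def using enough proj unfolding enough_projectives_def by blast
  moreover have "F = perp_inf C G" if hd: "defines_homological_dimension C F"
  proof -
    have last_syz: "X n \<in> F"
      if "finite_exact C n X d M" "\<forall>i<n. X i \<in> F" "M \<in> dim_class C F (enat n)" for n X d M
      using conjunct2[OF hd[unfolded defines_homological_dimension_def]] that by blast
    \<comment> \<open>\<open>K\<close> is the end of an exact sequence with \<open>n = 1\<close> over \<open>M\<close>, whose \<open>F\<close>-dimension is at most \<open>1\<close>.\<close>
    have syz: "K \<in> F" if M: "M \<in> F" and s: "short_exact C K k P e M" and P: "projective C P" for M K k P e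
    proof -
      have dim: "M \<in> dim_class C F (enat 1)" using member_in_dim_class M FO by blast
      have "\<forall>i<1. (case_nat P (\<lambda>_. K) i) \<in> F" using proj[OF P] by simp
      from last_syz[OF short_exact_finite_exact[OF s] this dim] show ?thesis by simp
    qed
    have "ext_vanishes C N j M" if "M \<in> F" "N \<in> G" for M N j
      using that(1)
    proof (induction j arbitrary: M)
      case 0
      then have "\<forall>j<m. ext_vanishes C N j M" using F that(2) by blast
      then show ?case using assms(4) by (metis One_nat_def Suc_le_lessD)
    next
      case (Suc j)
      then show ?case unfolding ext_vanishes.simps(2) using syz by metis
    qed
    then show ?thesis unfolding inf using FO F by blast
  qed
  moreover have "defines_homological_dimension C F" if eq: "F = perp_inf C G"
    unfolding defines_homological_dimension_def
  proof (intro conjI allI impI; elim conjE)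
    fix K k A g M assume "short_exact C K k A g M"
    then have K: "K \<in> Obj C" using short_exactD(8) by blast
    then obtain P d where "proj_resolution C K P d" using ex_proj_resolution by blast
    then show "K \<in> dim_class C F \<infinity>"
      unfolding dim_class_def proj_resolution_def using proj K by auto
  next
    fix n X d M assume ex: "finite_exact C n X d M" and X: "\<forall>i<n. X i \<in> F" and M: "M \<in> dim_class C F (enat n)"
    have van: "ext_vanishes C N j Y" if "Y \<in> F \<or> zero_object C Y" "N \<in> G" for Y N j
      using that eq inf ext_vanishes_projective[OF zero_object_projective] by blast
    obtain Y d' where L: "long_exact C Y d' M" and Y: "\<And>i. Y i \<in> F \<or> zero_object C (Y i)"
      and z: "\<And>i. n < i \<Longrightarrow> zero_object C (Y i)"
      using M unfolding dim_class_def by auto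
    have "ext_vanishes C N j (X n)" if N: "N \<in> G" for N j
    proof (rule ext_vanishes_last_syzygy[OF ex])
      show "ext_vanishes C N j (X i)" if "i < n" for i j using van X N that by blast
      show "ext_vanishes C N j M" if "n \<le> j" for j
        by (rule ext_vanishes_above_dimension[OF L van[OF Y N] z _ that]) (use N assms(3) in auto)
    qed
    moreover have "X n \<in> Obj C"
      using ex hom_arr(4) unfolding finite_exact_def by (cases n) auto
    ultimately show "X n \<in> F" unfolding eq inf by blast
  qed
  ultimately show ?thesis by blast
qed

end
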